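(* Fix integers $0\le k<m$, $n\ge1$, $0\le l<r$. Let $\sigma:I^m\to J^r(\mathbb R^m,\mathbb R^n)$ be a smooth section such that $\sigma=0$ on an open neighborhood of $\partial I^m$ and $\sigma^{(l)}=0$ on all of $I^m$. Then for every $\varepsilon>0$ there exist an isotopy $F_t:I^m\to I^m$ and a holonomic section $\hat\sigma:I^m\to J^r(\mathbb R^m,\mathbb R^n)$ such that: $\mathrm{dist}_{C^0}(\hat\sigma,\sigma)<\varepsilon$ on an open neighborhood of $F_1(I^k)$; $\|\hat\sigma^{(l)}\|_{C^0}<\varepsilon$ on all of $I^m$; $\mathrm{dist}_{C^0}(F_t,\mathrm{id})<\varepsilon$; and $F_t=\mathrm{id}_{I^m}$ and $\hat\sigma=0$ on an open neighborhood of $\partial I^m$.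
   Context: $I=[-1,1]$ and $I^k\subset I^m$ is $I^k\times\{0\}^{m-k}$. $J^r(\mathbb R^m,\mathbb R^n)$ is the space of $r$-jets of maps $\mathbb R^m\to\mathbb R^n$, identified with $\mathbb R^m\times(\mathcal P_r)^n$ via Taylor polynomials of degree $\le r$; it is a vector bundle over $\mathbb R^m$ with the linear structure coming from $\mathbb R^n$, and $0$ denotes the zero section ($r$-jet of the zero map). $\sigma^{(l)}$ denotes the $l$-jet component (truncation of the Taylor polynomial to degree $\le l$). A section is holonomic if it equals $j^r(h)$ for a smooth $h:I^m\to\mathbb R^n$. *)

theory Defs
  imports "HOL-Analysis.Analysis"
begin

definition dderiv :: "'a::real_normed_vector \<Rightarrow> ('a \<Rightarrow> 'b::real_normed_vector) \<Rightarrow> 'a \<Rightarrow> 'b" where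
  "dderiv v f x = vector_derivative (\<lambda>t. f (x + t *\<^sub>R v)) (at 0)"

fun iter_pd :: "'a::real_normed_vector list \<Rightarrow> ('a \<Rightarrow> 'b::real_normed_vector) \<Rightarrow> 'a \<Rightarrow> 'b" where
  "iter_pd [] f = f"
| "iter_pd (v # vs) f = dderiv v (iter_pd vs f)"

definition smooth_on :: "'a::euclidean_space set \<Rightarrow> ('a \<Rightarrow> 'b::real_normed_vector) \<Rightarrow> bool" where
  "smooth_on S f \<longleftrightarrow> open S \<and>
     (\<forall>vs. set vs \<subseteq> Basis \<longrightarrow>
        continuous_on S (iter_pd vs f) \<and>
        (\<forall>v\<in>Basis. \<forall>x\<in>S. (\<lambda>t. iter_pd vs f (x + t *\<^sub>R v)) differentiable (at 0)))"

definition cube :: "(real^'m) set" where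
  "cube = {x. \<forall>i. \<bar>x $ i\<bar> \<le> 1}"

definition subcube :: "'m set \<Rightarrow> (real^'m) set" where
  "subcube K = {x \<in> cube. \<forall>i. i \<notin> K \<longrightarrow> x $ i = 0}"

definition mdeg :: "('m::finite \<Rightarrow> nat) \<Rightarrow> nat" where
  "mdeg \<alpha> = (\<Sum>i\<in>UNIV. \<alpha> i)"

definition mfact :: "('m::finite \<Rightarrow> nat) \<Rightarrow> real" where
  "mfact \<alpha> = (\<Prod>i\<in>UNIV. fact (\<alpha> i))"

text \<open>A fixed enumeration of the coordinate indices (the order is irrelevant for
  smooth functions, since partial derivatives commute).\<close>
definition coord_enum :: "'m::finite list" where
  "coord_enum = (SOME xs. distinct xs \<and> set xs = UNIV)"

definition mpderiv :: "('m::finite \<Rightarrow> nat) \<Rightarrow> (real^'m \<Rightarrow> real^'n) \<Rightarrow> real^'m \<Rightarrow> real^'n" where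
  "mpderiv \<alpha> f = iter_pd (concat (map (\<lambda>i. replicate (\<alpha> i) (axis i (1::real))) coord_enum)) f"

text \<open>An r-jet at a point is represented by the coefficients of its Taylor polynomial:
  a function from multi-indices to R^n; only multi-indices of degree <= r are relevant.
  A section of J^r(R^m,R^n) is a map real^'m => (('m => nat) => real^'n).
  The r-jet of h: coefficient of (y-x)^alpha is D^alpha h(x) / alpha!.\<close>
definition jet :: "nat \<Rightarrow> (real^'m::finite \<Rightarrow> real^'n) \<Rightarrow> real^'m \<Rightarrow> ('m \<Rightarrow> nat) \<Rightarrow> real^'n" where
  "jet r h x \<alpha> = (if mdeg \<alpha> \<le> r then mpderiv \<alpha> h x /\<^sub>R mfact \<alpha> else 0)"

text \<open>Norm of the l-jet component (truncation to degree <= l) of a jet value; for l = r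
  it is the norm on the fibre of J^r.  (Any norm on the finite-dimensional fibre works.)\<close>
definition jet_norm :: "nat \<Rightarrow> (('m::finite \<Rightarrow> nat) \<Rightarrow> real^'n) \<Rightarrow> real" where
  "jet_norm l s = Max ((\<lambda>\<alpha>. norm (s \<alpha>)) ` {\<alpha>. mdeg \<alpha> \<le> l})"

definition jet_zero :: "nat \<Rightarrow> (('m::finite \<Rightarrow> nat) \<Rightarrow> real^'n) \<Rightarrow> bool" where
  "jet_zero l s \<longleftrightarrow> (\<forall>\<alpha>. mdeg \<alpha> \<le> l \<longrightarrow> s \<alpha> = 0)"

definition isotopy :: "(real \<Rightarrow> real^'m::finite \<Rightarrow> real^'m) \<Rightarrow> bool" where
  "isotopy F \<longleftrightarrow>
     (\<exists>W. {0..1} \<times> cube \<subseteq> W \<and> smooth_on W (\<lambda>(t,x). F t x)) \<and>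
     (\<forall>x\<in>cube. F 0 x = x) \<and>
     (\<forall>t\<in>{0..1}. bij_betw (F t) cube cube \<and>
        (\<exists>S g. cube \<subseteq> S \<and> smooth_on S g \<and> (\<forall>x\<in>cube. g (F t x) = x)))"

end

theory Submission
  imports Defs
begin

text \<open>
  Enlarging \<open>K\<close> we may wiggle a coordinate hyperplane \<open>y = 0\<close>, and all deformed hyperplanes are graphs
  \<open>y = Y(x)\<close> with \<open>Y\<close> independent of \<open>y\<close>. The basic step realises one coefficient \<open>c \<cdot> L\<^sup>a \<cdot> (dy - dY)\<^sup>b\<close>
  of order \<open>s = a + b\<close>, \<open>L\<close> a linear form in \<open>x\<close>, by the convex-integration type formula
  \<open>h = c N\<^sup>-\<^sup>a d\<^sup>b P (N L, (y - Y) / d)\<close> with \<open>N d\<close> large: derivatives of order below \<open>s\<close> are small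
  everywhere. The profile \<open>P (u, v)\<close> is, near the curve \<open>v = sin u\<close>, of the form
  \<open>v\<^sup>b / b! \<cdot> (u\<^sup>a / a! + lower order in u)\<close>. A function that is periodic in \<open>u\<close> cannot be such a polynomial
  in \<open>u\<close> along a line \<open>v = const\<close>, but along the curve it can: two sawtooth functions jump where \<open>sin u\<close> is
  \<open>1\<close> and \<open>-1\<close> respectively, and a cutoff in \<open>v\<close> always selects one that does not jump. So near the new
  graph \<open>Y + d sin (N L)\<close> the order \<open>s\<close> derivatives of \<open>h\<close> are the prescribed ones.
  Powers of linear forms span all monomials in \<open>x\<close>. The twist by \<open>dY\<close> only affects components with fewer
  factors \<open>dy\<close>, so for each order \<open>s\<close> one treats \<open>b = s, \<dots>, 0\<close> in turn, each time correcting the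
  remaining error, and then passes to order \<open>s + 1\<close>.
\<close>

section \<open>Smooth functions\<close>

text \<open>A step of order \<open>s\<close> gives no bound on derivatives of higher order, nor on
  those of order \<open>s\<close> away from the new graph or with too few factors \<open>dy\<close>.
  So only what is already settled is carried along, and only in a tube around the current graph. The
  next graph moves by less than half the width of that tube, so the earlier estimates survive on a
  smaller tube. The remaining error may be large: a coefficient of any size can be realised with
  arbitrarily small lower order derivatives, at the price of a higher frequency. The first
  derivatives of \<open>Y\<close> may become huge, and yet the final graph is reached by a small
  isotopy. It shifts points along the \<open>y\<close> axis, and on each such line \<open>Y\<close>
  is constant, so smallness of the values of \<open>Y\<close> is all that invertibility requires.
  Smoothness is defined by iterated partial derivatives along basis vectors. It is proved
  accordingly, by exhibiting families of continuous functions that are closed under these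
  derivatives.\<close>

abbreviation smooth :: "('a::euclidean_space \<Rightarrow> 'b::real_normed_vector) \<Rightarrow> bool" where
  "smooth f \<equiv> smooth_on UNIV f"

section \<open>Directional derivatives and smoothness by coinduction\<close>

definition has_dderiv :: "'a::real_normed_vector \<Rightarrow> ('a \<Rightarrow> 'b::real_normed_vector) \<Rightarrow> 'b \<Rightarrow> 'a \<Rightarrow> bool" where
  "has_dderiv v f d x \<longleftrightarrow> ((\<lambda>t. f (x + t *\<^sub>R v)) has_vector_derivative d) (at 0)"

lemma has_dderiv_imp_dderiv: "has_dderiv v f d x \<Longrightarrow> dderiv v f x = d"
  unfolding has_dderiv_def dderiv_def by (rule vector_derivative_at)

lemma differentiable_imp_has_dderiv:
  "(\<lambda>t. f (x + t *\<^sub>R v)) differentiable (at 0) \<Longrightarrow> has_dderiv v f (dderiv v f x) x"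
  unfolding has_dderiv_def dderiv_def by (simp add: vector_derivative_works)

lemma iter_pd_append: "iter_pd (us @ vs) f = iter_pd us (iter_pd vs f)"
  by (induction us) auto

lemma has_dderiv_transform:
  assumes "has_dderiv v f d x" "open S" "x \<in> S" "\<And>y. y \<in> S \<Longrightarrow> f y = g y"
  shows "has_dderiv v g d x"
proof -
  let ?T = "(\<lambda>t::real. x + t *\<^sub>R v) -` S"
  have "open ?T"
    by (intro open_vimage continuous_intros assms)
  moreover have "0 \<in> ?T" using assms by simp
  ultimately show ?thesis
    using assms unfolding has_dderiv_def
    by (auto intro: has_vector_derivative_transform_within_open)
qed

lemma dderiv_cong_open:
  assumes "open S" "x \<in> S" "\<And>y. y \<in> S \<Longrightarrow> f y = g y"
  shows "dderiv v f x = dderiv v g x"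
proof -
  have "((\<lambda>t. f (x + t *\<^sub>R v)) has_vector_derivative d) (at 0) \<longleftrightarrow>
        ((\<lambda>t. g (x + t *\<^sub>R v)) has_vector_derivative d) (at 0)" for d
    using has_dderiv_transform[of v f d x S g] has_dderiv_transform[of v g d x S f] assms
    unfolding has_dderiv_def by metis
  then show ?thesis unfolding dderiv_def vector_derivative_def by simp
qed

lemma iter_pd_cong_open:
  assumes "open S" "x \<in> S" "\<And>y. y \<in> S \<Longrightarrow> f y = g y"
  shows "iter_pd vs f x = iter_pd vs g x"
  using assms(2)
proof (induction vs arbitrary: x)
  case (Cons v vs)
  then show ?case using dderiv_cong_open[OF assms(1) Cons.prems, of "iter_pd vs f" "iter_pd vs g" v] by simp
qed (use assms in auto)

text \<open>Iterated derivatives of \<open>f\<close> never leave \<open>\<F>\<close>, so conditions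
  on single members of \<open>\<F>\<close> cover derivatives of all orders at once. Most later
  smoothness proofs only have to choose \<open>\<F>\<close>.\<close>

lemma smooth_coinduct:
  assumes "f \<in> \<F>"
    and "\<And>f. f \<in> \<F> \<Longrightarrow> continuous_on UNIV f"
    and der: "\<And>f v. f \<in> \<F> \<Longrightarrow> v \<in> Basis \<Longrightarrow> \<exists>f'\<in>\<F>. \<forall>x. has_dderiv v f (f' x) x"
  shows "smooth f"
proof -
  have *: "iter_pd vs f \<in> \<F>" if "set vs \<subseteq> Basis" for vs
    using that
  proof (induction vs)
    case (Cons v vs)
    then obtain f' where "f' \<in> \<F>" "\<And>x. has_dderiv v (iter_pd vs f) (f' x) x"
      using der[of "iter_pd vs f" v] by auto
    moreover from this have "dderiv v (iter_pd vs f) = f'"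
      using has_dderiv_imp_dderiv by blast
    ultimately show ?case by simp
  qed (use assms in auto)
  show ?thesis
    unfolding smooth_on_def
  proof (intro conjI allI impI ballI open_UNIV)
    fix vs :: "'a list" assume vs: "set vs \<subseteq> Basis"
    show "continuous_on UNIV (iter_pd vs f)" using * assms(2) vs by blast
    fix v :: 'a and x assume "v \<in> Basis"
    then obtain f' where "has_dderiv v (iter_pd vs f) (f' x) x"
      using der[OF *[OF vs]] by blast
    then show "(\<lambda>t. iter_pd vs f (x + t *\<^sub>R v)) differentiable at 0"
      unfolding has_dderiv_def by (rule differentiableI_vector)
  qed
qed

lemma smooth_continuous: "smooth f \<Longrightarrow> continuous_on UNIV f"
  unfolding smooth_on_def by (metis empty_set empty_subsetI iter_pd.simps(1))

lemma smooth_has_dderiv: "smooth f \<Longrightarrow> v \<in> Basis \<Longrightarrow> has_dderiv v f (dderiv v f x) x"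
  unfolding smooth_on_def
  by (rule differentiable_imp_has_dderiv) (metis empty_set empty_subsetI iter_pd.simps(1) UNIV_I)

lemma smooth_dderiv: "smooth f \<Longrightarrow> v \<in> Basis \<Longrightarrow> smooth (dderiv v f)"
  unfolding smooth_on_def
proof (intro conjI allI impI ballI open_UNIV; elim conjE)
  fix vs :: "'a list"
  assume *: "v \<in> Basis" "set vs \<subseteq> Basis" "\<forall>vs. set vs \<subseteq> Basis \<longrightarrow>
       continuous_on UNIV (iter_pd vs f) \<and>
       (\<forall>v\<in>Basis. \<forall>x\<in>UNIV. (\<lambda>t. iter_pd vs f (x + t *\<^sub>R v)) differentiable at 0)"
  \<comment> \<open>\<open>iter_pd\<close> applies the last entry of the list first, so a derivative
    taken beforehand is appended at the end.\<close>
  have eq: "iter_pd vs (dderiv v f) = iter_pd (vs @ [v]) f"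
    by (simp add: iter_pd_append)
  have "set (vs @ [v]) \<subseteq> Basis" using * by auto
  note 1 = *(3)[rule_format, OF this]
  show "continuous_on UNIV (iter_pd vs (dderiv v f))" using 1 eq by simp
  fix w x assume "w \<in> (Basis::'a set)"
  then show "(\<lambda>t. iter_pd vs (dderiv v f) (x + t *\<^sub>R w)) differentiable at 0" using 1 eq by simp
qed

lemma smooth_iter_pd: "smooth f \<Longrightarrow> set vs \<subseteq> Basis \<Longrightarrow> smooth (iter_pd vs f)"
  by (induction vs) (auto intro: smooth_dderiv)

text \<open>Serves functions defined by cases: the sawtooth, whose jumps lie where a cutoff
  vanishes, and the target, extended by zero beyond the cube.\<close>

lemma smooth_on_local:
  assumes "\<And>x. \<exists>U g. x \<in> U \<and> smooth_on U g \<and> (\<forall>y\<in>U. f y = g y)"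
  shows "smooth f"
  unfolding smooth_on_def
proof (intro conjI allI impI ballI open_UNIV)
  fix vs :: "'a list" assume vs: "set vs \<subseteq> Basis"
  have eq: "\<exists>U g. open U \<and> x \<in> U \<and> smooth_on U g \<and> (\<forall>y\<in>U. iter_pd vs g y = iter_pd vs f y)" for x
  proof -
    obtain U g where U: "x \<in> U \<and> smooth_on U g \<and> (\<forall>y\<in>U. f y = g y)" using assms[of x] by (elim exE)
    moreover from this have "open U" unfolding smooth_on_def by (elim conjE)
    moreover have "iter_pd vs g y = iter_pd vs f y" if "y \<in> U" for y
      using iter_pd_cong_open[OF \<open>open U\<close> that, of g f] U by metis
    ultimately show ?thesis by blast
  qed
  have "isCont (iter_pd vs f) x" for x
  proof -
    obtain U g where U': "open U \<and> x \<in> U \<and> smooth_on U g \<and> (\<forall>y\<in>U. iter_pd vs g y = iter_pd vs f y)"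
      using eq[of x] by (elim exE)
    then have U: "open U" "x \<in> U" "smooth_on U g" "\<And>y. y\<in>U \<Longrightarrow> iter_pd vs g y = iter_pd vs f y" by simp_all
    then have "continuous_on U (iter_pd vs g)" using vs unfolding smooth_on_def by blast
    then have "continuous_on U (iter_pd vs f)" using U by (simp cong: continuous_on_cong)
    then show ?thesis using U continuous_on_eq_continuous_at by blast
  qed
  then show "continuous_on UNIV (iter_pd vs f)"
    by (simp add: continuous_at_imp_continuous_on)
  fix v x assume v: "v \<in> (Basis::'a set)"
  obtain U g where U': "open U \<and> x \<in> U \<and> smooth_on U g \<and> (\<forall>y\<in>U. iter_pd vs g y = iter_pd vs f y)"
    using eq[of x] by (elim exE)
  then have U: "open U" "x \<in> U" "smooth_on U g" "\<And>y. y\<in>U \<Longrightarrow> iter_pd vs g y = iter_pd vs f y" by simp_all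
  then have "(\<lambda>t. iter_pd vs g (x + t *\<^sub>R v)) differentiable at 0"
    using v vs unfolding smooth_on_def by blast
  then have "has_dderiv v (iter_pd vs g) (dderiv v (iter_pd vs g) x) x"
    by (rule differentiable_imp_has_dderiv)
  then have "has_dderiv v (iter_pd vs f) (dderiv v (iter_pd vs g) x) x"
    using has_dderiv_transform U by blast
  then show "(\<lambda>t. iter_pd vs f (x + t *\<^sub>R v)) differentiable at 0"
    unfolding has_dderiv_def by (rule differentiableI_vector)
qed

lemma smooth_on_subset: "smooth_on T f \<Longrightarrow> open S \<Longrightarrow> S \<subseteq> T \<Longrightarrow> smooth_on S f"
  unfolding smooth_on_def by (meson continuous_on_subset subset_eq)

lemma smooth_imp_smooth_on: "smooth f \<Longrightarrow> open S \<Longrightarrow> smooth_on S f"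
  using smooth_on_subset by blast

section \<open>Sums, products, composites and reciprocals\<close>

inductive_set alg :: "('a \<Rightarrow> real) set \<Rightarrow> ('a \<Rightarrow> real) set" for G where
  gen: "g \<in> G \<Longrightarrow> g \<in> alg G"
| add: "f \<in> alg G \<Longrightarrow> g \<in> alg G \<Longrightarrow> (\<lambda>x. f x + g x) \<in> alg G"
| mult: "f \<in> alg G \<Longrightarrow> g \<in> alg G \<Longrightarrow> (\<lambda>x. f x * g x) \<in> alg G"

lemma has_dderiv_add: "has_dderiv v f a x \<Longrightarrow> has_dderiv v g b x \<Longrightarrow> has_dderiv v (\<lambda>x. f x + g x) (a + b) x"
  unfolding has_dderiv_def by (rule has_vector_derivative_add)

lemma has_dderiv_scaleR:
  "has_dderiv v f a x \<Longrightarrow> has_dderiv v g b x \<Longrightarrow> has_dderiv v (\<lambda>x. f x *\<^sub>R g x) (f x *\<^sub>R b + a *\<^sub>R g x) x"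
  unfolding has_dderiv_def
  using has_vector_derivative_scaleR[of "\<lambda>t. f (x + t *\<^sub>R v)" a 0 UNIV "\<lambda>t. g (x + t *\<^sub>R v)" b]
  by (simp add: has_real_derivative_iff_has_vector_derivative)

lemma has_dderiv_mult:
  fixes f g :: "'a::real_normed_vector \<Rightarrow> real"
  shows "has_dderiv v f a x \<Longrightarrow> has_dderiv v g b x \<Longrightarrow> has_dderiv v (\<lambda>x. f x * g x) (f x * b + a * g x) x"
  using has_dderiv_scaleR[of v f a x g b] by simp

lemma has_dderiv_const: "has_dderiv v (\<lambda>x. c) 0 x"
  unfolding has_dderiv_def by (rule has_vector_derivative_const)

lemma has_dderiv_linear:
  assumes "bounded_linear f"
  shows "has_dderiv v f (f v) x"
proof -
  interpret bounded_linear f by fact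
  have "(\<lambda>t. f (x + t *\<^sub>R v)) = (\<lambda>t. f x + t *\<^sub>R f v)" by (auto simp: add scaleR)
  then show ?thesis
    unfolding has_dderiv_def by (auto intro!: derivative_eq_intros)
qed

lemma has_dderiv_chain:
  assumes "has_dderiv v f a x" "(\<phi> has_real_derivative b) (at (f x))"
  shows "has_dderiv v (\<lambda>x. \<phi> (f x)) (a * b) x"
  using field_vector_diff_chain_at[of "\<lambda>t. f (x + t *\<^sub>R v)" a 0 \<phi> b] assms
  unfolding has_dderiv_def by (simp add: o_def)

lemma has_dderiv_real_iff: "has_dderiv 1 f d x \<longleftrightarrow> (f has_real_derivative d) (at x)"
proof -
  have "((\<lambda>t. f (x + t)) has_real_derivative d) (at 0) \<longleftrightarrow> (f has_real_derivative d) (at x)"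
    using DERIV_shift[of f d 0 x] by (simp add: add.commute)
  then show ?thesis
    unfolding has_dderiv_def by (simp add: has_real_derivative_iff_has_vector_derivative)
qed

text \<open>By the product rule only generators have to be differentiated, and their derivatives may
  be polynomials in all generators. This suits reciprocals, composites and implicit functions, whose
  derivatives involve the functions themselves.\<close>

lemma smooth_alg:
  assumes cont: "\<And>g. g \<in> G \<Longrightarrow> continuous_on UNIV g"
    and der: "\<And>g v. g \<in> G \<Longrightarrow> v \<in> Basis \<Longrightarrow> \<exists>g'\<in>alg G. \<forall>x. has_dderiv v g (g' x) x"
    and "f \<in> alg G"
  shows "smooth f"
  using assms(3)
proof (rule smooth_coinduct)
  fix f assume "f \<in> alg G"
  then show "continuous_on UNIV f"
    by induction (auto intro: continuous_intros cont)
next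
  fix f v assume "f \<in> alg G" and v: "v \<in> (Basis::'a set)"
  then show "\<exists>f'\<in>alg G. \<forall>x. has_dderiv v f (f' x) x"
  proof induction
    case (gen g)
    then show ?case using der v by blast
  next
    case (add f g)
    then obtain f' g' where "f' \<in> alg G" "g' \<in> alg G"
      "\<And>x. has_dderiv v f (f' x) x" "\<And>x. has_dderiv v g (g' x) x" by auto
    then show ?case
      by (intro bexI[of _ "\<lambda>x. f' x + g' x"]) (auto intro: alg.intros has_dderiv_add)
  next
    case (mult f g)
    then obtain f' g' where "f' \<in> alg G" "g' \<in> alg G"
      "\<And>x. has_dderiv v f (f' x) x" "\<And>x. has_dderiv v g (g' x) x" by auto
    with mult show ?case
      by (intro bexI[of _ "\<lambda>x. f x * g' x + f' x * g x"])
        (auto intro: alg.intros has_dderiv_mult)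
  qed
qed

lemma smooth_generator:
  assumes "smooth f" "v \<in> Basis" "{f. smooth f} \<subseteq> G"
  shows "\<exists>g'\<in>alg G. \<forall>x. has_dderiv v f (g' x) x"
  using assms smooth_dderiv smooth_has_dderiv by (blast intro: alg.gen)

lemma smooth_linear: "bounded_linear f \<Longrightarrow> smooth f"
proof (rule smooth_coinduct[where \<F> = "{f} \<union> range (\<lambda>c x. c)"], goal_cases)
  case (2 g)
  then show ?case by (auto intro: continuous_intros linear_continuous_on)
next
  case (3 g v)
  then consider "g = f" | c where "g = (\<lambda>x. c)" by blast
  then show ?case
  proof cases
    case 1
    then show ?thesis using 3 has_dderiv_linear[of f v] by (intro bexI[of _ "\<lambda>x. f v"]) auto
  next
    case 2
    then show ?thesis using has_dderiv_const[of v] by (intro bexI[of _ "\<lambda>x. 0"]) auto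
  qed
qed auto

lemma smooth_const: "smooth (\<lambda>x. c)"
  by (rule smooth_coinduct[where \<F> = "range (\<lambda>c x. c)"])
    (auto intro: continuous_intros has_dderiv_const)

lemma smooth_add:
  assumes "smooth f" "smooth g"
  shows "smooth (\<lambda>x. f x + g x)"
proof (rule smooth_coinduct[where \<F> = "{(\<lambda>x. f x + g x) | f g. smooth f \<and> smooth g}"], goal_cases)
  case (2 h)
  then show ?case by (auto intro!: continuous_on_add dest: smooth_continuous)
next
  case (3 h v)
  then obtain f g where *: "h = (\<lambda>x. f x + g x)" "smooth f" "smooth g" by blast
  with 3 show ?case
    by (intro bexI[of _ "\<lambda>x. dderiv v f x + dderiv v g x"])
      (auto intro!: has_dderiv_add smooth_has_dderiv smooth_dderiv)
qed (use assms in auto)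

text \<open>The vector-valued counterpart of \<open>alg\<close>: the product rule turns one product
  into a sum of two, so sums of products are what is closed under differentiation.\<close>

inductive_set scaleR_span :: "('a::euclidean_space \<Rightarrow> 'b::real_normed_vector) set" where
  scaleR: "smooth f \<Longrightarrow> smooth g \<Longrightarrow> (\<lambda>x. f x *\<^sub>R g x) \<in> scaleR_span"
| add: "f \<in> scaleR_span \<Longrightarrow> g \<in> scaleR_span \<Longrightarrow> (\<lambda>x. f x + g x) \<in> scaleR_span"

lemma smooth_scaleR:
  assumes "smooth f" "smooth g"
  shows "smooth (\<lambda>x. f x *\<^sub>R g x)"
  using scaleR_span.scaleR[OF assms]
proof (rule smooth_coinduct)
  fix h :: "'a \<Rightarrow> 'b" assume "h \<in> scaleR_span"
  then show "continuous_on UNIV h"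
    by induction (auto intro: continuous_intros dest: smooth_continuous)
next
  fix h :: "'a \<Rightarrow> 'b" and v :: 'a assume "h \<in> scaleR_span" and v: "v \<in> Basis"
  then show "\<exists>f'\<in>scaleR_span. \<forall>x. has_dderiv v h (f' x) x"
  proof induction
    case (scaleR f g)
    then show ?case using v
      by (intro bexI[of _ "\<lambda>x. f x *\<^sub>R dderiv v g x + dderiv v f x *\<^sub>R g x"])
        (auto intro!: scaleR_span.add[OF scaleR_span.scaleR scaleR_span.scaleR] has_dderiv_scaleR
          smooth_has_dderiv smooth_dderiv)
  next
    case (add f g)
    then obtain f' g' where "f' \<in> scaleR_span" "g' \<in> scaleR_span"
      "\<And>x. has_dderiv v f (f' x) x" "\<And>x. has_dderiv v g (g' x) x" by auto
    then show ?case
      by (intro bexI[of _ "\<lambda>x. f' x + g' x"]) (auto intro: scaleR_span.intros has_dderiv_add)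
  qed
qed

lemma smooth_mult:
  fixes f g :: "'a::euclidean_space \<Rightarrow> real"
  shows "smooth f \<Longrightarrow> smooth g \<Longrightarrow> smooth (\<lambda>x. f x * g x)"
  using smooth_scaleR[of f g] by simp

lemma smooth_diff:
  assumes "smooth f" "smooth g"
  shows "smooth (\<lambda>x. f x - g x)"
  using smooth_add[OF assms(1) smooth_scaleR[OF smooth_const[of "-1"] assms(2)]] by simp

lemma smooth_power:
  fixes f :: "'a::euclidean_space \<Rightarrow> real"
  shows "smooth f \<Longrightarrow> smooth (\<lambda>x. f x ^ n)"
  by (induction n) (auto intro: smooth_const smooth_mult)

lemma smooth_prod:
  fixes f :: "'i \<Rightarrow> 'a::euclidean_space \<Rightarrow> real"
  assumes "\<And>i. i \<in> I \<Longrightarrow> smooth (f i)"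
  shows "smooth (\<lambda>x. \<Prod>i\<in>I. f i x)"
  using assms by (induction I rule: infinite_finite_induct) (auto intro: smooth_const smooth_mult)

lemma smooth_real_DERIV:
  fixes \<phi> :: "real \<Rightarrow> real"
  shows "smooth \<phi> \<Longrightarrow> (\<phi> has_real_derivative dderiv 1 \<phi> x) (at x)"
  using smooth_has_dderiv[of \<phi> 1 x] by (simp add: has_dderiv_real_iff)

lemma smooth_compose:
  fixes \<phi> :: "real \<Rightarrow> real"
  assumes "smooth \<phi>" "smooth f"
  shows "smooth (\<lambda>x. \<phi> (f x))"
proof (rule smooth_alg[where G = "{f. smooth f} \<union> {(\<lambda>x. \<phi> (f x)) | \<phi>. smooth \<phi>}"], goal_cases)
  case (1 g)
  then show ?case
    using assms by (auto intro!: continuous_on_compose2[of UNIV _ UNIV f] dest!: smooth_continuous)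
next
  case (2 g v)
  then consider "smooth g" | \<phi> where "g = (\<lambda>x. \<phi> (f x))" "smooth \<phi>" by blast
  then show ?case
  proof cases
    case 1
    then show ?thesis using 2 by (intro smooth_generator) auto
  next
    case \<phi>: 2
    have "has_dderiv v g (dderiv v f x * dderiv 1 \<phi> (f x)) x" for x
      unfolding \<phi>(1) using \<phi> 2 assms
      by (intro has_dderiv_chain smooth_has_dderiv smooth_real_DERIV)
    moreover have "smooth (dderiv v f)" "smooth (dderiv 1 \<phi>)"
      using assms 2 \<phi> by (auto intro!: smooth_dderiv)
    then have "(\<lambda>x. dderiv v f x * dderiv 1 \<phi> (f x)) \<in> alg ({f. smooth f} \<union> {(\<lambda>x. \<phi> (f x)) | \<phi>. smooth \<phi>})"
      by (intro alg.mult) (auto intro: alg.gen)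
    ultimately show ?thesis
      by (intro bexI[of _ "\<lambda>x. dderiv v f x * dderiv 1 \<phi> (f x)"]) simp_all
  qed
next
  case 3
  then show ?case using assms by (auto intro!: alg.gen)
qed

lemma smooth_inverse:
  fixes f :: "'a::euclidean_space \<Rightarrow> real"
  assumes "smooth f" "\<And>x. f x \<noteq> 0"
  shows "smooth (\<lambda>x. inverse (f x))"
proof (rule smooth_alg[where G = "{f. smooth f} \<union> {\<lambda>x. inverse (f x)}"], goal_cases)
  case (1 g)
  then show ?case
    using assms by (auto intro!: continuous_on_inverse dest!: smooth_continuous)
next
  case (2 g v)
  then consider "smooth g" | "g = (\<lambda>x. inverse (f x))" by blast
  then show ?case
  proof cases
    case 1
    then show ?thesis using 2 by (intro smooth_generator) auto
  next
    case g: 2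
    have "has_dderiv v g (dderiv v f x * - (inverse (f x) ^ Suc (Suc 0))) x" for x
      unfolding g using 2 assms
      by (intro has_dderiv_chain smooth_has_dderiv DERIV_inverse)
    moreover have "smooth (\<lambda>x. - dderiv v f x)"
      using smooth_mult[OF smooth_const[of "-1"], of "dderiv v f"] assms 2 by (simp add: smooth_dderiv)
    then have "(\<lambda>x. - dderiv v f x * (inverse (f x) * inverse (f x))) \<in> alg ({f. smooth f} \<union> {\<lambda>x. inverse (f x)})"
      by (intro alg.mult) (auto intro: alg.gen)
    ultimately show ?thesis
      by (intro bexI[of _ "\<lambda>x. - dderiv v f x * (inverse (f x) * inverse (f x))"]) simp_all
  qed
qed (auto intro!: alg.gen)

lemma smooth_sin: "smooth (sin :: real \<Rightarrow> real)"
proof (rule smooth_alg[where G = "{sin, cos, \<lambda>x::real. -1}"], goal_cases)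
  case (2 g v)
  let ?G = "{sin, cos, \<lambda>x::real. -1::real}"
  have "v = 1" using 2 by auto
  consider "g = sin" | "g = cos" | "g = (\<lambda>x. -1)" using 2 by auto
  then show ?case
  proof cases
    case 1
    then show ?thesis unfolding 1 \<open>v = 1\<close> has_dderiv_real_iff
      by (intro bexI[of _ cos]) (auto intro: alg.gen derivative_eq_intros)
  next
    case 2
    have "(\<lambda>x. -1 * sin x) \<in> alg ?G" by (intro alg.mult alg.gen) auto
    then show ?thesis unfolding 2 \<open>v = 1\<close> has_dderiv_real_iff
      by (intro bexI[of _ "\<lambda>x. -1 * sin x"]) (auto intro!: derivative_eq_intros)
  next
    case 3
    \<comment> \<open>The algebra has no constants except those it generates; this expression is
      zero.\<close>
    have "(\<lambda>x. -1 * -1 + -1) \<in> alg ?G" by (intro alg.mult alg.gen alg.add) auto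
    then show ?thesis unfolding 3 \<open>v = 1\<close> has_dderiv_real_iff
      by (intro bexI[of _ "\<lambda>x. -1 * -1 + -1"]) (auto intro!: derivative_eq_intros)
  qed
qed (auto intro: continuous_intros alg.intros)

section \<open>Cutoff functions and the oscillating profile\<close>

lemma iter_pd_add:
  assumes "smooth f" "smooth g" "set vs \<subseteq> Basis"
  shows "iter_pd vs (\<lambda>x. f x + g x) = (\<lambda>x. iter_pd vs f x + iter_pd vs g x)"
  using assms(3)
proof (induction vs)
  case (Cons v vs)
  then show ?case using assms
    by (auto intro!: has_dderiv_imp_dderiv has_dderiv_add smooth_has_dderiv smooth_iter_pd)
qed simp

section \<open>Flat functions, smooth steps and bumps\<close>

definition flat_exp :: "nat \<Rightarrow> real \<Rightarrow> real" where
  "flat_exp n x = (if x \<le> 0 then 0 else inverse x ^ n * exp (- inverse x))"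

lemma flat_exp_tendsto_0: "(flat_exp n \<longlongrightarrow> 0) (at 0)"
proof -
  have "((\<lambda>x. inverse x ^ n / exp (inverse x)) \<longlongrightarrow> 0) (at_right (0::real))"
    by (rule filterlim_compose[OF tendsto_power_div_exp_0 filterlim_inverse_at_top_right])
  moreover have "eventually (\<lambda>x. inverse x ^ n / exp (inverse x) = flat_exp n x) (at_right 0)"
    by (simp add: flat_exp_def exp_minus divide_inverse eventually_at_right_less eventually_mono[OF eventually_at_right_less])
  ultimately have "(flat_exp n \<longlongrightarrow> 0) (at_right 0)"
    using Lim_transform_eventually by blast
  moreover have "(flat_exp n \<longlongrightarrow> 0) (at_left 0)"
    by (rule tendsto_eventually)
      (auto simp: flat_exp_def eventually_at_left_field intro!: exI[of _ "-1"])
  ultimately show ?thesis by (simp add: filterlim_split_at)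
qed

text \<open>The powers of \<open>inverse x\<close> are included so that differentiation stays within
  linear combinations of the family. At \<open>0\<close> the difference quotient of one member is
  the next member, which tends to \<open>0\<close>.\<close>

lemma DERIV_flat_exp:
  "(flat_exp n has_real_derivative (- real n * flat_exp (Suc n) x + flat_exp (Suc (Suc n)) x)) (at x)"
proof -
  consider "x < 0" | "x = 0" | "x > 0" by linarith
  then show ?thesis
  proof cases
    case 1
    have "((\<lambda>x. 0) has_real_derivative 0) (at x)" by simp
    then have "(flat_exp n has_real_derivative 0) (at x)"
      by (rule has_field_derivative_transform_within_open[of _ _ _ "{..<0}"])
        (use 1 in \<open>auto simp: flat_exp_def\<close>)
    then show ?thesis using 1 by (simp add: flat_exp_def)
  next
    case 2
    have "(\<lambda>h. (flat_exp n (0 + h) - flat_exp n 0) / h) = flat_exp (Suc n)"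
      by (auto simp: flat_exp_def fun_eq_iff divide_inverse)
    then have "(flat_exp n has_real_derivative 0) (at 0)"
      unfolding DERIV_def using flat_exp_tendsto_0 by simp
    then show ?thesis using 2 by (simp add: flat_exp_def)
  next
    case 3
    have inv: "(inverse has_real_derivative - (inverse x ^ Suc (Suc 0))) (at x)"
      using 3 by (intro DERIV_inverse) simp
    have "((\<lambda>x. inverse x ^ n) has_real_derivative (- real n * inverse x ^ Suc n)) (at x)"
      using DERIV_power[OF inv, of n] by (cases n) (simp_all add: algebra_simps)
    moreover have "((\<lambda>x. exp (- inverse x)) has_real_derivative (exp (- inverse x) * inverse x ^ 2)) (at x)"
      using DERIV_fun_exp[OF DERIV_minus[OF inv]] by (simp add: power2_eq_square)
    ultimately have "((\<lambda>x. inverse x ^ n * exp (- inverse x)) has_real_derivative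
        (- real n * inverse x ^ Suc n * exp (- inverse x) + exp (- inverse x) * inverse x ^ 2 * inverse x ^ n)) (at x)"
      by (rule DERIV_mult)
    moreover have "- real n * inverse x ^ Suc n * exp (- inverse x) + exp (- inverse x) * inverse x ^ 2 * inverse x ^ n
        = - real n * flat_exp (Suc n) x + flat_exp (Suc (Suc n)) x"
      using 3 by (simp add: flat_exp_def power2_eq_square)
    ultimately have "((\<lambda>x. inverse x ^ n * exp (- inverse x)) has_real_derivative
        (- real n * flat_exp (Suc n) x + flat_exp (Suc (Suc n)) x)) (at x)" by simp
    then show ?thesis
      by (rule has_field_derivative_transform_within_open[of _ _ _ "{0<..}"])
        (use 3 in \<open>auto simp: flat_exp_def\<close>)
  qed
qed

lemma smooth_flat_exp: "smooth (flat_exp n)"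
proof (rule smooth_alg[where G = "range flat_exp \<union> range (\<lambda>c x. c)"], goal_cases)
  case (1 g)
  then show ?case
    by (auto intro!: continuous_at_imp_continuous_on DERIV_isCont[OF DERIV_flat_exp])
next
  case (2 g v)
  then have v: "v = 1" by simp
  from 2 consider m where "g = flat_exp m" | c where "g = (\<lambda>x. c)" by blast
  then show ?case
  proof cases
    case (1 m)
    have "(\<lambda>x. - real m * flat_exp (Suc m) x + flat_exp (Suc (Suc m)) x)
        \<in> alg (range flat_exp \<union> range (\<lambda>c x. c))"
      by (intro alg.add alg.mult alg.gen) auto
    then show ?thesis
      unfolding 1 v has_dderiv_real_iff by (rule bexI[rotated]) (intro allI DERIV_flat_exp)
  next
    case (2 c)
    then show ?thesis
      by (intro bexI[of _ "\<lambda>x. 0"]) (auto intro: has_dderiv_const alg.gen)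
  qed
qed (auto intro: alg.gen)

lemma smooth_step_exists:
  fixes a b :: real
  assumes "a < b"
  obtains \<rho> :: "real \<Rightarrow> real" where "smooth \<rho>" "\<And>x. x \<le> a \<Longrightarrow> \<rho> x = 0" "\<And>x. x \<ge> b \<Longrightarrow> \<rho> x = 1"
    "\<And>x. 0 \<le> \<rho> x" "\<And>x. \<rho> x \<le> 1"
proof
  let ?e = "flat_exp 0"
  let ?f = "\<lambda>x. ?e (x - a)" and ?g = "\<lambda>x. ?e (b - x)"
  let ?\<rho> = "\<lambda>x. ?f x * inverse (?f x + ?g x)"
  have pos: "?e x > 0" if "x > 0" for x using that by (simp add: flat_exp_def)
  have nn: "?e x \<ge> 0" for x by (simp add: flat_exp_def)
  have sum_pos: "?f x + ?g x > 0" for x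
    using pos[of "x - a"] pos[of "b - x"] nn[of "x - a"] nn[of "b - x"] assms
    by (cases "x > a") linarith+
  have "smooth ?f" "smooth ?g"
    by (intro smooth_compose[OF smooth_flat_exp] smooth_diff smooth_const smooth_linear bounded_linear_ident)+
  moreover have "?f x + ?g x \<noteq> 0" for x using sum_pos[of x] by linarith
  ultimately show "smooth ?\<rho>"
    by (intro smooth_mult smooth_inverse smooth_add)
  show "?\<rho> x = 0" if "x \<le> a" for x using that by (simp add: flat_exp_def)
  show "?\<rho> x = 1" if "x \<ge> b" for x
    using that sum_pos[of x] by (simp add: flat_exp_def)
  show "0 \<le> ?\<rho> x" for x using sum_pos[of x] nn[of "x - a"] by simp
  show "?\<rho> x \<le> 1" for x
    using sum_pos[of x] nn[of "x - a"] nn[of "b - x"] by (simp add: field_simps)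
qed

lemma smooth_bump_exists:
  fixes a b :: real
  assumes "0 \<le> a" "a < b"
  obtains \<theta> :: "real \<Rightarrow> real" where "smooth \<theta>" "\<And>x. \<bar>x\<bar> \<le> a \<Longrightarrow> \<theta> x = 1" "\<And>x. \<bar>x\<bar> \<ge> b \<Longrightarrow> \<theta> x = 0"
    "\<And>x. 0 \<le> \<theta> x" "\<And>x. \<theta> x \<le> 1"
proof -
  obtain \<rho> :: "real \<Rightarrow> real" where \<rho>: "smooth \<rho>" "\<And>x. x \<le> -b \<Longrightarrow> \<rho> x = 0" "\<And>x. x \<ge> -a \<Longrightarrow> \<rho> x = 1"
    "\<And>x. 0 \<le> \<rho> x" "\<And>x. \<rho> x \<le> 1"
    by (rule smooth_step_exists[of "-b" "-a"]) (use assms in simp, rule that)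
  have "smooth (\<lambda>x. \<rho> (0 - x))"
    by (intro smooth_compose[OF \<rho>(1)] smooth_diff smooth_const smooth_linear bounded_linear_ident)
  then have "smooth (\<lambda>x. \<rho> x * \<rho> (0 - x))" by (intro smooth_mult \<rho>(1))
  moreover have "\<rho> x * \<rho> (0 - x) = 1" if "\<bar>x\<bar> \<le> a" for x using that \<rho>(3)[of x] \<rho>(3)[of "0-x"] by auto
  moreover have "\<rho> x * \<rho> (0 - x) = 0" if "\<bar>x\<bar> \<ge> b" for x
    using that \<rho>(2)[of x] \<rho>(2)[of "0-x"] by (cases "x \<ge> 0") auto
  moreover have "0 \<le> \<rho> x * \<rho> (0 - x)" "\<rho> x * \<rho> (0 - x) \<le> 1" for x
    using \<rho>(4,5)[of x] \<rho>(4,5)[of "0-x"] by (auto intro: mult_le_one)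
  ultimately show thesis by (rule that)
qed

section \<open>Iterated derivatives in one variable\<close>

abbreviation nder :: "nat \<Rightarrow> (real \<Rightarrow> real) \<Rightarrow> real \<Rightarrow> real" where
  "nder k f \<equiv> iter_pd (replicate k 1) f"

lemma set_replicate_Basis: "set (replicate k (1::real)) \<subseteq> Basis"
  by (auto simp: set_replicate_conv_if)

lemma smooth_nder: "smooth f \<Longrightarrow> smooth (nder k f)"
  by (rule smooth_iter_pd[OF _ set_replicate_Basis])

lemma DERIV_nder: "smooth f \<Longrightarrow> (nder k f has_real_derivative nder (Suc k) f x) (at x)"
  using smooth_real_DERIV[OF smooth_nder] by simp

lemma nder_monomial:
  "nder k (\<lambda>u. (u - c) ^ a / fact a) = (\<lambda>u. if k \<le> a then (u - c) ^ (a - k) / fact (a - k) else 0)"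
proof (induction k)
  case (Suc k)
  have "((\<lambda>u. if k \<le> a then (u - c) ^ (a - k) / fact (a - k) else 0) has_real_derivative
     (if Suc k \<le> a then (u - c) ^ (a - Suc k) / fact (a - Suc k) else 0)) (at u)" for u
  proof (cases "Suc k \<le> a")
    case True
    then obtain d where d: "a - k = Suc d" "a - Suc k = d" by (metis Suc_diff_le diff_Suc_Suc)
    have "((\<lambda>u. (u - c) ^ Suc d / fact (Suc d)) has_real_derivative
      ((1 + real d) * (u - c) ^ d) / fact (Suc d)) (at u)"
      by (auto intro!: derivative_eq_intros simp del: power_Suc fact_Suc)
    moreover have "((1 + real d) * (u - c) ^ d) / fact (Suc d) = (u - c) ^ d / fact d"
      by (simp add: add_pos_nonneg mult_divide_mult_cancel_left less_imp_neq[symmetric])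
    ultimately show ?thesis using True d by simp
  next
    case False
    then have "k > a \<or> a = k" by linarith
    then show ?thesis by auto
  qed
  then have "dderiv 1 (\<lambda>u. if k \<le> a then (u - c) ^ (a - k) / fact (a - k) else 0) =
      (\<lambda>u. if Suc k \<le> a then (u - c) ^ (a - Suc k) / fact (a - Suc k) else 0)"
    unfolding has_dderiv_real_iff[symmetric] by (intro ext has_dderiv_imp_dderiv)
  then show ?case using Suc by simp
qed simp

lemma nder_shift: "nder k (\<lambda>u. f (u + c)) = (\<lambda>u. nder k f (u + c))"
proof (induction k)
  case (Suc k)
  have "dderiv 1 (\<lambda>u. nder k f (u + c)) x = dderiv 1 (nder k f) (x + c)" for x
    unfolding dderiv_def by (simp add: algebra_simps)
  then show ?case using Suc by simp
qed simp

lemma bounded_of_compact_support: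
  fixes f :: "'a::euclidean_space \<Rightarrow> 'b::real_normed_vector"
  assumes "continuous_on UNIV f" "compact S" "\<And>x. x \<notin> S \<Longrightarrow> f x = 0"
  shows "\<exists>K. \<forall>x. norm (f x) \<le> K"
proof -
  have "bounded (f ` S)"
    using assms by (meson compact_continuous_image compact_imp_bounded continuous_on_subset subset_UNIV)
  then obtain K where "K > 0" "\<And>x. x \<in> S \<Longrightarrow> norm (f x) \<le> K"
    by (auto simp: bounded_pos)
  then show ?thesis using assms(3) by (metis norm_zero order_less_imp_le)
qed

lemma periodic_bounded:
  fixes f :: "real \<Rightarrow> real"
  assumes "continuous_on UNIV f" "\<And>x. f (x + p) = f x" "p > 0"
  shows "\<exists>K. \<forall>x. \<bar>f x\<bar> \<le> K"
proof -
  have "bounded (f ` {0..p})"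
    using assms by (meson compact_Icc compact_continuous_image compact_imp_bounded continuous_on_subset subset_UNIV)
  then obtain K where K: "\<And>x. x \<in> {0..p} \<Longrightarrow> \<bar>f x\<bar> \<le> K"
    unfolding bounded_iff by (metis image_eqI real_norm_def)
  have pn: "f (x + real n * p) = f x" for x n
  proof (induction n)
    case (Suc n)
    have "x + real (Suc n) * p = (x + real n * p) + p" by (simp add: algebra_simps)
    then show ?case using Suc assms(2) by metis
  qed simp
  have pi: "f (x + of_int k * p) = f x" for x k
  proof (cases "k \<ge> 0")
    case True
    then show ?thesis using pn[of x "nat k"] by simp
  next
    case False
    then show ?thesis using pn[of "x + of_int k * p" "nat (-k)"] by simp
  qed
  have "\<bar>f x\<bar> \<le> K" for x
  proof -
    define k where "k = \<lfloor>x / p\<rfloor>"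
    have "of_int k \<le> x / p" "x / p < of_int k + 1" unfolding k_def by linarith+
    then have "x + of_int (-k) * p \<in> {0..p}" using assms(3) by (auto simp: field_simps)
    then show ?thesis using K pi[of x "-k"] by metis
  qed
  then show ?thesis by blast
qed

section \<open>The sawtooth and the two-variable profile\<close>

lemma sawtooth_exists:
  obtains S :: "real \<Rightarrow> real" where "smooth S" "\<And>u. S (u + 2 * pi) = S u"
    "\<And>u. sin u < 5/8 \<Longrightarrow> \<exists>U c. open U \<and> u \<in> U \<and> (\<forall>y\<in>U. S y = (y - c) ^ a / fact a)"
proof -
  obtain \<rho> :: "real \<Rightarrow> real" where \<rho>: "smooth \<rho>" "\<And>x. x \<le> -3/4 \<Longrightarrow> \<rho> x = 0" "\<And>x. x \<ge> -5/8 \<Longrightarrow> \<rho> x = 1"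
    "\<And>x. 0 \<le> \<rho> x" "\<And>x. \<rho> x \<le> 1"
    by (rule smooth_step_exists[of "-3/4" "-5/8"]) (simp, rule that)
  \<comment> \<open>\<open>n\<close> numbers the intervals between consecutive points with
    \<open>sin u = 1\<close>; subtracting \<open>2 * pi * n\<close> makes the monomial periodic,
    with jumps at these points only.\<close>
  define n where "n u = \<lfloor>(u - pi/2) / (2 * pi)\<rfloor>" for u :: real
  \<comment> \<open>The cutoff vanishes where \<open>sin u\<close> is at least \<open>3/4\<close>,
    which hides the jumps, and is \<open>1\<close> where \<open>sin u\<close> is at most
    \<open>5/8\<close>.\<close>
  define S where "S u = \<rho> (0 - sin u) * ((u - 2 * pi * of_int (n u)) ^ a / fact a)" for u
  have n_const: "\<exists>U. open U \<and> u \<in> U \<and> (\<forall>y\<in>U. n y = n u)" if "sin u < 1" for u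
  proof -
    let ?g = "\<lambda>y. (y - pi/2) / (2 * pi)"
    let ?U = "{y. of_int (n u) < ?g y} \<inter> {y. ?g y < of_int (n u) + 1}"
    have "open ?U"
      by (intro open_Int open_Collect_less continuous_intros) auto
    moreover have "?g u \<noteq> of_int (n u)"
    proof
      assume "?g u = of_int (n u)"
      then have "u = pi/2 + of_int (n u) * (2 * pi)" by (simp add: field_simps)
      then have "sin u = sin (pi/2 + of_int (n u) * (2 * pi))" by simp
      also have "\<dots> = 1" by (simp add: sin_add mult.commute[of _ "2 * pi"])
      finally show False using that by simp
    qed
    moreover have "of_int (n u) \<le> ?g u" "?g u < of_int (n u) + 1" unfolding n_def by linarith+
    ultimately have "u \<in> ?U" by auto
    moreover have "\<forall>y\<in>?U. n y = n u" unfolding n_def[of y for y] by (auto intro!: floor_unique)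
    ultimately show ?thesis using \<open>open ?U\<close> by blast
  qed
  have sm: "smooth (\<lambda>u. \<rho> (0 - sin u))"
    by (intro smooth_compose[OF \<rho>(1)] smooth_diff smooth_const smooth_sin)
  have "smooth S"
  proof (rule smooth_on_local)
    fix u
    show "\<exists>U g. u \<in> U \<and> smooth_on U g \<and> (\<forall>y\<in>U. S y = g y)"
    proof (cases "sin u < 1")
      case True
      then obtain U where U: "open U" "u \<in> U" "\<And>y. y \<in> U \<Longrightarrow> n y = n u" using n_const[OF True] by auto
      let ?g = "\<lambda>y. \<rho> (0 - sin y) * ((y - 2 * pi * of_int (n u)) ^ a * inverse (fact a))"
      have "smooth (\<lambda>y::real. y)"
        by (rule smooth_linear[OF bounded_linear_ident])
      then have "smooth (\<lambda>y. (y - 2 * pi * of_int (n u)) ^ a)"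
        by (rule smooth_power[OF smooth_diff[OF _ smooth_const]])
      then have "smooth ?g"
        by (rule smooth_mult[OF sm smooth_mult[OF _ smooth_const]])
      then have "smooth_on U ?g" by (rule smooth_imp_smooth_on[OF _ U(1)])
      moreover have "S y = ?g y" if "y \<in> U" for y
        using U(3)[OF that] by (simp add: S_def divide_inverse)
      ultimately show ?thesis using U(2) by blast
    next
      case False
      have "open {y::real. 3/4 < sin y}" by (intro open_Collect_less continuous_intros)
      then have "smooth_on {y::real. 3/4 < sin y} (\<lambda>y. 0::real)"
        by (rule smooth_imp_smooth_on[OF smooth_const])
      then show ?thesis using False \<rho>(2)
        by (intro exI[of _ "{y. 3/4 < sin y}"] exI[of _ "\<lambda>y. 0"]) (simp add: S_def)
    qed
  qed
  moreover have "S (u + 2 * pi) = S u" for u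
  proof -
    have "(u + 2 * pi - pi/2) / (2 * pi) = (u - pi/2) / (2 * pi) + 1" by (simp add: field_simps)
    then have "n (u + 2 * pi) = n u + 1" unfolding n_def by simp
    moreover have "sin (u + 2 * pi) = sin u" by (simp add: sin_add)
    ultimately show ?thesis unfolding S_def by (simp add: algebra_simps)
  qed
  moreover have "\<exists>U c. open U \<and> u \<in> U \<and> (\<forall>y\<in>U. S y = (y - c) ^ a / fact a)" if "sin u < 5/8" for u
  proof -
    have "sin u < 1" using that by simp
    obtain U where U: "open U" "u \<in> U" "\<And>y. y \<in> U \<Longrightarrow> n y = n u" using n_const[OF \<open>sin u < 1\<close>] by auto
    have "open {y::real. sin y < 5/8}" by (intro open_Collect_less continuous_intros)
    moreover have "S y = (y - 2 * pi * of_int (n u)) ^ a / fact a" if "y \<in> U" "sin y < 5/8" for y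
      using U(3)[OF that(1)] that(2) \<rho>(3)[of "0 - sin y"] by (simp add: S_def)
    ultimately show ?thesis using U(1,2) that
      by (intro exI[of _ "U \<inter> {y. sin y < 5/8}"] exI[of _ "2 * pi * of_int (n u)"]) auto
  qed
  ultimately show thesis by (rule that)
qed

lemma nder_locally_monomial:
  assumes "open U" "u \<in> U" "\<And>y. y \<in> U \<Longrightarrow> f y = (y - c) ^ a / fact a"
  shows "nder a f u = 1" "k > a \<Longrightarrow> nder k f u = 0"
  using iter_pd_cong_open[OF assms(1,2), of f "\<lambda>y. (y - c) ^ a / fact a"] assms(3)
  by (auto simp: nder_monomial)

lemma nder_locally_zero:
  assumes "open U" "u \<in> U" "\<And>y. y \<in> U \<Longrightarrow> f y = 0"
  shows "nder k f u = 0"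
proof -
  have "nder k (\<lambda>_. 0) = (\<lambda>_. 0)"
    by (induction k) (simp_all add: has_dderiv_imp_dderiv[OF has_dderiv_const])
  then show ?thesis using iter_pd_cong_open[OF assms(1,2), of f "\<lambda>_. 0"] assms(3) by auto
qed

text \<open>\<open>P i k\<close> is the derivative, \<open>i\<close> times in \<open>v\<close> and
  \<open>k\<close> times in \<open>u\<close>, of one function
  \<open>S u * T0 v + S (u + pi) * T1 v\<close>. Handing over the whole array together with its
  chain rule replaces calculus in two variables. In \<open>u\<close> only orders from
  \<open>a\<close> on are prescribed, since the centre of the monomial varies from interval to
  interval.\<close>

lemma profile_exists:
  obtains P :: "nat \<Rightarrow> nat \<Rightarrow> real \<Rightarrow> real \<Rightarrow> real"
  where "\<And>i k. continuous_on UNIV (\<lambda>z. P i k (fst z) (snd z))"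
    "\<And>i k. \<exists>C. \<forall>u v. \<bar>P i k u v\<bar> \<le> C"
    "\<And>i k e f g df dg (x::'a::euclidean_space). has_dderiv e f df x \<Longrightarrow> has_dderiv e g dg x \<Longrightarrow>
       has_dderiv e (\<lambda>x. P i k (f x) (g x)) (df * P i (Suc k) (f x) (g x) + dg * P (Suc i) k (f x) (g x)) x"
    "\<And>i k u v. \<bar>v - sin u\<bar> < 1/8 \<Longrightarrow> k > a \<Longrightarrow> P i k u v = 0"
    "\<And>u v. \<bar>v - sin u\<bar> < 1/8 \<Longrightarrow> P b a u v = 1"
proof -
  obtain S :: "real \<Rightarrow> real" where S: "smooth S" "\<And>u. S (u + 2 * pi) = S u"
    and S_loc: "\<And>u. sin u < 5/8 \<Longrightarrow> \<exists>U c. open U \<and> u \<in> U \<and> (\<forall>y\<in>U. S y = (y - c) ^ a / fact a)"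
    by (rule sawtooth_exists[of a]) (rule that)
  obtain \<rho> :: "real \<Rightarrow> real" where \<rho>: "smooth \<rho>" "\<And>x. x \<le> -1/4 \<Longrightarrow> \<rho> x = 0" "\<And>x. x \<ge> 1/4 \<Longrightarrow> \<rho> x = 1"
    "\<And>x. 0 \<le> \<rho> x" "\<And>x. \<rho> x \<le> 1"
    by (rule smooth_step_exists[of "-1/4" "1/4"]) (simp, rule that)
  obtain \<theta> :: "real \<Rightarrow> real" where \<theta>: "smooth \<theta>" "\<And>x. \<bar>x\<bar> \<le> 2 \<Longrightarrow> \<theta> x = 1" "\<And>x. \<bar>x\<bar> \<ge> 3 \<Longrightarrow> \<theta> x = 0"
    "\<And>x. 0 \<le> \<theta> x" "\<And>x. \<theta> x \<le> 1"
    by (rule smooth_bump_exists[of 2 3]) (simp, simp, rule that)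
  \<comment> \<open>\<open>T\<close> equals \<open>v ^ b / b!\<close> for
    \<open>\<bar>v\<bar>\<close> up to \<open>2\<close>, hence on the whole strip around the sine
    curve. \<open>T1\<close> and \<open>T0\<close> split it into a part that vanishes for
    \<open>v\<close> below \<open>-1/4\<close> and one that vanishes above
    \<open>1/4\<close>.\<close>
  define T where "T v = \<theta> v * ((v - 0) ^ b * inverse (fact b))" for v
  define T1 where "T1 v = \<rho> v * T v" for v
  define T0 where "T0 v = (1 - \<rho> v) * T v" for v
  have sT: "smooth T" unfolding T_def[abs_def]
    by (rule smooth_mult[OF \<theta>(1) smooth_mult[OF smooth_power[OF smooth_diff[OF
            smooth_linear[OF bounded_linear_ident] smooth_const]] smooth_const]])
  have sT1: "smooth T1" and sT0: "smooth T0" unfolding T1_def[abs_def] T0_def[abs_def]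
    by (rule smooth_mult[OF \<rho>(1) sT], rule smooth_mult[OF smooth_diff[OF smooth_const \<rho>(1)] sT])
  have T_eq: "T v = (v - 0) ^ b / fact b" if "\<bar>v\<bar> < 2" for v
    using that \<theta> by (simp add: T_def divide_inverse)
  have T_sum: "nder i T0 v + nder i T1 v = nder i T v" for i v
    using iter_pd_add[OF sT0 sT1 set_replicate_Basis, of i]
    by (simp add: T0_def T1_def algebra_simps fun_eq_iff)
  define P where "P i k u v = nder k S u * nder i T0 v + nder k S (u + pi) * nder i T1 v" for i k u v
  have cont: "continuous_on UNIV (nder k f)" if "smooth f" for k f
    using that smooth_nder smooth_continuous by blast
  have S_top: "nder a S u = 1" "k > a \<Longrightarrow> nder k S u = 0" if "sin u < 5/8" for u k
    using S_loc[OF that] nder_locally_monomial[of _ u S _ a] by blast+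
  show thesis
  proof (rule that[of P], goal_cases)
    case (1 i k)
    show ?case unfolding P_def
      by (intro continuous_intros continuous_on_compose2[OF cont[OF S(1)]]
          continuous_on_compose2[OF cont[OF sT0]] continuous_on_compose2[OF cont[OF sT1]]) auto
  next
    case (2 i k)
    have "nder k S (u + 2 * pi) = nder k S u" for u
      using nder_shift[of k S, where c = "2 * pi"] S(2) by (simp add: fun_eq_iff)
    then obtain A where A: "\<And>u. \<bar>nder k S u\<bar> \<le> A"
      using periodic_bounded[OF cont[OF S(1)], of k "2 * pi"] by auto
    have T_bdd: "\<exists>K. \<forall>v. \<bar>nder i f v\<bar> \<le> K" if "smooth f" "\<And>v. \<bar>v\<bar> \<ge> 3 \<Longrightarrow> f v = 0" for f
    proof -
      have "nder i f v = 0" if "v \<notin> {-3..3}" for v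
        using that \<open>\<And>v. \<bar>v\<bar> \<ge> 3 \<Longrightarrow> f v = 0\<close>
        by (intro nder_locally_zero[of "- {-3..3}"]) (auto simp: open_Compl)
      then show ?thesis
        using bounded_of_compact_support[OF cont[OF that(1)], of "{-3..3}" i] by auto
    qed
    have "\<And>v. \<bar>v\<bar> \<ge> 3 \<Longrightarrow> T v = 0" using \<theta> by (simp add: T_def)
    then obtain B C where B: "\<And>v. \<bar>nder i T0 v\<bar> \<le> B" "\<And>v. \<bar>nder i T1 v\<bar> \<le> C"
      using T_bdd[OF sT0] T_bdd[OF sT1] by (auto simp: T0_def T1_def)
    have "\<bar>P i k u v\<bar> \<le> A * B + A * C" for u v
    proof -
      have "A \<ge> 0" using A[of 0] by linarith
      have "\<bar>P i k u v\<bar> \<le> \<bar>nder k S u\<bar> * \<bar>nder i T0 v\<bar> + \<bar>nder k S (u + pi)\<bar> * \<bar>nder i T1 v\<bar>"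
        unfolding P_def by (metis abs_mult abs_triangle_ineq)
      also have "\<dots> \<le> A * B + A * C"
        using A B \<open>A \<ge> 0\<close> by (intro add_mono mult_mono) auto
      finally show ?thesis .
    qed
    then show ?case by blast
  next
    case (3 i k e f g df dg x)
    have "has_dderiv e (\<lambda>x. f x + pi) (df + 0) x"
      by (intro has_dderiv_add 3 has_dderiv_const)
    then have "has_dderiv e (\<lambda>x. f x + pi) df x" by simp
    note * = has_dderiv_add[OF has_dderiv_mult[OF has_dderiv_chain[OF 3(1) DERIV_nder[OF S(1)]]
        has_dderiv_chain[OF 3(2) DERIV_nder[OF sT0]]]
        has_dderiv_mult[OF has_dderiv_chain[OF this DERIV_nder[OF S(1)]]
        has_dderiv_chain[OF 3(2) DERIV_nder[OF sT1]]], of k i k i]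
    show ?case unfolding P_def
      by (rule subst[of _ _ "\<lambda>d. has_dderiv e _ d x", OF _ *]) (simp add: algebra_simps)
  next
    case (4 i k u v)
    \<comment> \<open>If \<open>sin u > 1/2\<close>, closeness to the curve forces
      \<open>v > 3/8\<close>, where only \<open>T1\<close> survives, and its factor
      \<open>S (u + pi)\<close> is a monomial there. The bottom is symmetric. In between both
      sawtooths are monomials, perhaps with different centres, and derivatives of order at least
      \<open>a\<close> do not see the centre.\<close>
    consider "sin u > 1/2" | "sin u < -1/2" | "\<bar>sin u\<bar> \<le> 1/2" by linarith
    then show ?case
    proof cases
      case 1
      have "v > 1/4" using 1 4(1) by linarith
      then have "nder i T0 v = 0"
        using \<rho> by (intro nder_locally_zero[of "{1/4<..}"]) (auto simp: T0_def)
      then show ?thesis using 1 4 S_top(2)[of "u + pi" k] by (simp add: P_def)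
    next
      case 2
      have "v < -1/4" using 2 4(1) by linarith
      then have "nder i T1 v = 0"
        using \<rho> by (intro nder_locally_zero[of "{..<-1/4}"]) (auto simp: T1_def)
      then show ?thesis using 2 4 S_top(2)[of u k] by (simp add: P_def)
    next
      case 3
      then show ?thesis using 4 S_top(2)[of u k] S_top(2)[of "u + pi" k] by (simp add: P_def)
    qed
  next
    case (5 u v)
    have v: "\<bar>v\<bar> < 2" using 5 abs_sin_le_one[of u] by linarith
    consider "sin u > 1/2" | "sin u < -1/2" | "\<bar>sin u\<bar> \<le> 1/2" by linarith
    then show ?case
    proof cases
      case 1
      have "v > 1/4" using 1 5(1) by linarith
      moreover from this have "nder b T0 v = 0"
        using \<rho> by (intro nder_locally_zero[of "{1/4<..}"]) (auto simp: T0_def)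
      moreover have "nder b T1 v = 1"
        using \<open>v > 1/4\<close> \<rho> v T_eq by (intro nder_locally_monomial(1)[of "{1/4<..<2}" _ _ 0]) (auto simp: T1_def)
      ultimately show ?thesis using 1 S_top(1)[of "u + pi"] by (simp add: P_def)
    next
      case 2
      have "v < -1/4" using 2 5(1) by linarith
      moreover from this have "nder b T1 v = 0"
        using \<rho> by (intro nder_locally_zero[of "{..<-1/4}"]) (auto simp: T1_def)
      moreover have "nder b T0 v = 1"
        using \<open>v < -1/4\<close> \<rho> v T_eq by (intro nder_locally_monomial(1)[of "{-2<..<-1/4}" _ _ 0]) (auto simp: T0_def)
      ultimately show ?thesis using 2 S_top(1)[of u] by (simp add: P_def)
    next
      case 3
      \<comment> \<open>In the middle range both sawtooths have top derivative \<open>1\<close>, so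
        the two cutoff parts recombine to \<open>T\<close>.\<close>
      have "nder b T v = 1"
        using v T_eq by (intro nder_locally_monomial(1)[of "{-2<..<2}" _ _ 0]) auto
      then show ?thesis using 3 S_top(1)[of u] S_top(1)[of "u + pi"] T_sum[of b v] by (simp add: P_def)
    qed
  qed
qed

section \<open>A single oscillation\<close>

text \<open>Coefficients in the Leibniz expansion of a product of \<open>c\<close> with a function
  of a phase and a height. Each direction \<open>e\<close> differentiates the coefficient, the phase
  (factor \<open>w \<bullet> e\<close>, counted by \<open>k\<close>) or the height (factor
  \<open>n e x\<close>, counted by \<open>i\<close>).\<close>

fun expansion_coeff :: "'a::real_inner \<Rightarrow> ('a \<Rightarrow> 'a \<Rightarrow> real) \<Rightarrow> ('a \<Rightarrow> 'b::real_normed_vector) \<Rightarrow>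
    'a list \<Rightarrow> nat \<Rightarrow> nat \<Rightarrow> 'a \<Rightarrow> 'b" where
  "expansion_coeff w n c [] i k = (if i = 0 \<and> k = 0 then c else (\<lambda>x. 0))"
| "expansion_coeff w n c (e # vs) i k = (\<lambda>x. dderiv e (expansion_coeff w n c vs i k) x
     + (if k = 0 then 0 else (w \<bullet> e) *\<^sub>R expansion_coeff w n c vs i (k - 1) x)
     + (if i = 0 then 0 else n e x *\<^sub>R expansion_coeff w n c vs (i - 1) k x))"

text \<open>The value at \<open>w\<close> of the monomial formed by the directions other than
  \<open>y\<close>, that is, the tangential part of the principal symbol.\<close>

definition monomial_weight :: "'a::real_inner \<Rightarrow> 'a \<Rightarrow> 'a list \<Rightarrow> real" where
  "monomial_weight y w vs = prod_list (map ((\<bullet>) w) (filter (\<lambda>e. e \<noteq> y) vs))"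

lemma dderiv_zero: "dderiv v (\<lambda>x. 0) x = 0"
  by (rule has_dderiv_imp_dderiv[OF has_dderiv_const])

lemma smooth_expansion_coeff:
  assumes "smooth c" "\<And>e. e \<in> Basis \<Longrightarrow> smooth (n e)"
  shows "set vs \<subseteq> Basis \<Longrightarrow> smooth (expansion_coeff w n c vs i k)"
proof (induction vs arbitrary: i k)
  case Nil
  then show ?case using assms(1) smooth_const by auto
next
  case (Cons e vs)
  then have e: "e \<in> Basis" and IH: "smooth (expansion_coeff w n c vs i k)" for i k by auto
  have "smooth (\<lambda>x. if k = 0 then 0 else (w \<bullet> e) *\<^sub>R expansion_coeff w n c vs i (k - 1) x)"
    by (cases k) (simp_all add: smooth_const smooth_scaleR[OF smooth_const IH])
  moreover have "smooth (\<lambda>x. if i = 0 then 0 else n e x *\<^sub>R expansion_coeff w n c vs (i - 1) k x)"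
    by (cases i) (simp_all add: smooth_const smooth_scaleR[OF assms(2)[OF e] IH])
  ultimately show ?case
    using smooth_add[OF smooth_add[OF smooth_dderiv[OF IH e]]] by simp
qed

lemma expansion_coeff_outside:
  assumes "closed B" "\<And>x. x \<notin> B \<Longrightarrow> c x = 0" "x \<notin> B"
  shows "expansion_coeff w n c vs i k x = 0"
  using assms(3)
proof (induction vs arbitrary: i k x)
  case (Cons e vs)
  have "dderiv e (expansion_coeff w n c vs i k) x = dderiv e (\<lambda>x. 0) x"
    using Cons assms(1) by (intro dderiv_cong_open[of "- B"]) auto
  then show ?case using Cons by (simp add: dderiv_zero)
qed (use assms(2) in auto)

text \<open>Each entry of \<open>vs\<close> raises \<open>i + k\<close> by at most one.\<close>

lemma expansion_coeff_degree: "length vs < i + k \<Longrightarrow> expansion_coeff w n c vs i k = (\<lambda>x. 0)"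
proof (induction vs arbitrary: i k)
  case (Cons e vs)
  then have "expansion_coeff w n c vs i k = (\<lambda>x. 0)"
    "k > 0 \<Longrightarrow> expansion_coeff w n c vs i (k - 1) = (\<lambda>x. 0)"
    "i > 0 \<Longrightarrow> expansion_coeff w n c vs (i - 1) k = (\<lambda>x. 0)" by auto
  then show ?case by (cases i; cases k) (simp_all add: dderiv_zero)
qed auto

text \<open>The principal symbol: a derivative of order \<open>i + k\<close> in which \<open>y\<close> occurs at least \<open>i\<close> times
  does not see the slope of the graph.\<close>
lemma expansion_coeff_symbol:
  assumes "w \<bullet> y = 0" "\<And>x. n y x = 1"
  shows "i + k = length vs \<Longrightarrow> i \<le> count_list vs y \<Longrightarrow> expansion_coeff w n c vs i k x =
     (if count_list vs y = i then monomial_weight y w vs *\<^sub>R c x else 0)"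
proof (induction vs arbitrary: i k)
  case Nil
  then show ?case by (simp add: monomial_weight_def)
next
  case (Cons e vs)
  have 0: "expansion_coeff w n c vs i k = (\<lambda>x. 0)"
    using Cons.prems by (intro expansion_coeff_degree) simp
  have dz: "dderiv e (expansion_coeff w n c vs i k) x = 0"
    unfolding 0 by (rule dderiv_zero)
  show ?case
  proof (cases "e = y")
    case True
    then show ?thesis
      using Cons.prems Cons.IH[of "i - 1" k] assms count_le_length[of vs y] dz
      by (cases i) (auto simp: monomial_weight_def)
  next
    case False
    have "i > 0 \<Longrightarrow> expansion_coeff w n c vs (i - 1) k x = 0"
      using Cons.prems Cons.IH[of "i - 1" k] False by auto
    moreover have "k > 0"
      using Cons.prems False count_le_length[of vs y] by (cases k) auto
    then have "expansion_coeff w n c vs i (k - 1) x =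
      (if count_list vs y = i then monomial_weight y w vs *\<^sub>R c x else 0)"
      using Cons.prems False by (intro Cons.IH) auto
    ultimately show ?thesis
      using False \<open>k > 0\<close> dz by (auto simp: monomial_weight_def)
  qed
qed

text \<open>Shifts an index inside a sum truncated at a fixed bound; the term pushed over the upper
  end vanishes.\<close>

lemma sum_lessThan_shift_eq:
  fixes f g :: "nat \<Rightarrow> 'a::comm_monoid_add"
  assumes "f m = 0" "g 0 = 0" "\<And>k. g (Suc k) = f k"
  shows "(\<Sum>k<Suc m. g k) = (\<Sum>k<Suc m. f k)"
  by (subst sum.lessThan_Suc_shift) (simp add: assms)

lemma has_dderiv_sum:
  assumes "\<And>i. i \<in> I \<Longrightarrow> has_dderiv v (f i) (d i) x"
  shows "has_dderiv v (\<lambda>x. \<Sum>i\<in>I. f i x) (\<Sum>i\<in>I. d i) x"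
  using assms
  by (induction I rule: infinite_finite_induct) (auto intro: has_dderiv_const has_dderiv_add)

locale oscillation =
  fixes P :: "nat \<Rightarrow> nat \<Rightarrow> real \<Rightarrow> real \<Rightarrow> real"
    and y w :: "'a::euclidean_space" and Y :: "'a \<Rightarrow> real" and c :: "'a \<Rightarrow> 'b::real_normed_vector"
  assumes P_cont: "\<And>i k. continuous_on UNIV (\<lambda>z. P i k (fst z) (snd z))"
    and P_deriv: "\<And>i k e f g df dg (x::'a). has_dderiv e f df x \<Longrightarrow> has_dderiv e g dg x \<Longrightarrow>
       has_dderiv e (\<lambda>x. P i k (f x) (g x)) (df * P i (Suc k) (f x) (g x) + dg * P (Suc i) k (f x) (g x)) x"
    and smooth_Y: "smooth Y" and smooth_c: "smooth c"
begin

text \<open>The derivative in direction \<open>e\<close> of the height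
  \<open>x \<bullet> y - Y x\<close> above the graph.\<close>

definition "slope e x = e \<bullet> y - dderiv e Y x"

abbreviation "osc_coeff \<equiv> expansion_coeff w slope c"

lemma smooth_coeff: "set vs \<subseteq> Basis \<Longrightarrow> smooth (osc_coeff vs i k)"
proof (rule smooth_expansion_coeff[OF smooth_c])
  fix e :: 'a assume "e \<in> Basis"
  then show "smooth (slope e)"
    unfolding slope_def[abs_def] by (rule smooth_diff[OF smooth_const smooth_dderiv[OF smooth_Y]])
qed

text \<open>The powers of \<open>N\<close> and \<open>dl\<close> from the chain rule are built in.
  Differentiation thus turns waves into waves with coefficients free of \<open>N\<close> and
  \<open>dl\<close>, and this makes the later bounds uniform in the frequency.\<close>

definition "wave A N dl i k x = A * N ^ k * dl ^ i * P i k (N * (w \<bullet> x)) (dl * (x \<bullet> y - Y x))"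

lemma has_dderiv_wave:
  assumes "e \<in> Basis"
  shows "has_dderiv e (wave A N dl i k) ((w \<bullet> e) * wave A N dl i (Suc k) x + slope e x * wave A N dl (Suc i) k x) x"
proof -
  have 1: "has_dderiv e (\<lambda>x. N * (w \<bullet> x)) (N * (w \<bullet> e)) x"
    by (rule has_dderiv_linear) (intro bounded_linear_intros)
  have "has_dderiv e (\<lambda>x. x \<bullet> y + (-1) * Y x) (e \<bullet> y + ((-1) * dderiv e Y x + 0 * Y x)) x"
    by (intro has_dderiv_add has_dderiv_linear bounded_linear_intros has_dderiv_mult has_dderiv_const
        smooth_has_dderiv smooth_Y assms)
  from has_dderiv_mult[OF has_dderiv_const[of e dl] this]
  have 2: "has_dderiv e (\<lambda>x. dl * (x \<bullet> y - Y x)) (dl * slope e x) x"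
    by (simp add: slope_def)
  show ?thesis
    using has_dderiv_mult[OF has_dderiv_const[of e "A * N ^ k * dl ^ i"] P_deriv[OF 1 2, of i k]]
    by (simp add: wave_def[abs_def] algebra_simps)
qed

lemma smooth_wave: "smooth (wave A N dl i k)"
proof (rule smooth_alg[where G = "{f. smooth f} \<union> {wave A N dl i k |i k. True}"], goal_cases)
  case (1 g)
  have "continuous_on UNIV (wave A N dl i k)" for i k
    unfolding wave_def[abs_def]
    by (intro continuous_intros continuous_on_compose2[OF P_cont, of UNIV "\<lambda>x. (N * (w \<bullet> x), dl * (x \<bullet> y - Y x))", simplified]
        smooth_continuous[OF smooth_Y])
  then show ?case using 1 smooth_continuous by auto
next
  case (2 g e)
  let ?G = "{f. smooth f} \<union> {wave A N dl i k |i k. True}"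
  from 2 consider "smooth g" | i k where "g = wave A N dl i k" by blast
  then show ?case
  proof cases
    case 1
    then show ?thesis using 2 by (intro smooth_generator) auto
  next
    case (2 i k)
    have "smooth (slope e)"
      unfolding slope_def[abs_def] by (rule smooth_diff[OF smooth_const smooth_dderiv[OF smooth_Y]]) fact
    then have "(\<lambda>x. (w \<bullet> e) * wave A N dl i (Suc k) x + slope e x * wave A N dl (Suc i) k x) \<in> alg ?G"
      by (intro alg.add alg.mult alg.gen) (auto intro: smooth_const)
    then show ?thesis
      unfolding 2 by (rule bexI[rotated]) (intro allI has_dderiv_wave[OF \<open>e \<in> Basis\<close>])
  qed
qed (auto intro: alg.gen)

lemma iter_pd_wave:
  assumes "set vs \<subseteq> Basis" "length vs < R"
  shows "iter_pd vs (\<lambda>x. wave A N dl 0 0 x *\<^sub>R c x) = (\<lambda>x. \<Sum>i<R. \<Sum>k<R. wave A N dl i k x *\<^sub>R osc_coeff vs i k x)"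
  using assms
proof (induction vs)
  case Nil
  then obtain R' where R: "R = Suc R'" by (cases R) auto
  show ?case
    unfolding R
    by (simp add: sum.lessThan_Suc_shift del: sum.lessThan_Suc)
next
  case (Cons e vs)
  then obtain m where R: "R = Suc m" and m: "length vs < m" by (cases R) auto
  have e: "e \<in> Basis" and vs: "set vs \<subseteq> Basis" using Cons.prems by auto
  let ?W = "wave A N dl" and ?C = "osc_coeff vs"
  show ?case
  proof
    fix x
    have "has_dderiv e (\<lambda>x. \<Sum>i<R. \<Sum>k<R. ?W i k x *\<^sub>R ?C i k x)
      (\<Sum>i<R. \<Sum>k<R. ?W i k x *\<^sub>R dderiv e (?C i k) x +
         ((w \<bullet> e) * ?W i (Suc k) x + slope e x * ?W (Suc i) k x) *\<^sub>R ?C i k x) x"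
      by (intro has_dderiv_sum has_dderiv_scaleR has_dderiv_wave e smooth_has_dderiv[OF smooth_coeff[OF vs]])
    then have "iter_pd (e # vs) (\<lambda>x. ?W 0 0 x *\<^sub>R c x) x =
      (\<Sum>i<R. \<Sum>k<R. ?W i k x *\<^sub>R dderiv e (?C i k) x +
         ((w \<bullet> e) * ?W i (Suc k) x + slope e x * ?W (Suc i) k x) *\<^sub>R ?C i k x)"
      using Cons by (simp add: has_dderiv_imp_dderiv)
    also have "\<dots> = (\<Sum>i<R. \<Sum>k<R. ?W i k x *\<^sub>R dderiv e (?C i k) x)
        + (\<Sum>i<R. \<Sum>k<R. ((w \<bullet> e) * ?W i (Suc k) x) *\<^sub>R ?C i k x)
        + (\<Sum>i<R. \<Sum>k<R. (slope e x * ?W (Suc i) k x) *\<^sub>R ?C i k x)"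
      by (simp add: sum.distrib[symmetric] scaleR_left_distrib add.assoc)
    \<comment> \<open>A derivative of the wave is read as a shift of the coefficient index. The
      overflowing top term has coefficient zero because its index exceeds the number of
      derivatives.\<close>
    also have "(\<Sum>i<R. \<Sum>k<R. ((w \<bullet> e) * ?W i (Suc k) x) *\<^sub>R ?C i k x)
        = (\<Sum>i<R. \<Sum>k<R. ?W i k x *\<^sub>R (if k = 0 then 0 else (w \<bullet> e) *\<^sub>R ?C i (k - 1) x))"
      unfolding R using m
      by (intro sum.cong refl sum_lessThan_shift_eq[symmetric])
        (simp_all add: expansion_coeff_degree mult.commute)
    also have "(\<Sum>i<R. \<Sum>k<R. (slope e x * ?W (Suc i) k x) *\<^sub>R ?C i k x)
        = (\<Sum>i<R. \<Sum>k<R. ?W i k x *\<^sub>R (if i = 0 then 0 else slope e x *\<^sub>R ?C (i - 1) k x))"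
      unfolding R
      by (rule sum_lessThan_shift_eq[symmetric,
            of "\<lambda>i. \<Sum>k<Suc m. (slope e x * ?W (Suc i) k x) *\<^sub>R ?C i k x" m
              "\<lambda>i. \<Sum>k<Suc m. ?W i k x *\<^sub>R (if i = 0 then 0 else slope e x *\<^sub>R ?C (i - 1) k x)"])
        (use m in \<open>simp_all add: expansion_coeff_degree mult.commute\<close>)
    finally show "iter_pd (e # vs) (\<lambda>x. ?W 0 0 x *\<^sub>R c x) x =
        (\<Sum>i<R. \<Sum>k<R. ?W i k x *\<^sub>R osc_coeff (e # vs) i k x)"
      by (simp add: sum.distrib scaleR_right_distrib)
  qed
qed

end

text \<open>Independence of the direction \<open>y\<close> makes the set
  \<open>x \<bullet> y = Y x\<close> a graph. Vanishing where \<eta> does keeps the deformation away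
  from those boundary faces on which the cutoff in the direction \<open>y\<close> has no
  effect.\<close>

definition graph_fun :: "('a::euclidean_space \<Rightarrow> real) \<Rightarrow> 'a \<Rightarrow> ('a \<Rightarrow> real) \<Rightarrow> bool" where
  "graph_fun \<eta> y Y \<longleftrightarrow> smooth Y \<and> (\<forall>x t. Y (x + t *\<^sub>R y) = Y x) \<and> (\<forall>x. \<eta> x = 0 \<longrightarrow> Y x = 0)"

lemma graph_fun_dderiv: "graph_fun \<eta> y Y \<Longrightarrow> dderiv y Y x = 0"
  unfolding graph_fun_def dderiv_def by simp

text \<open>Frequency \<open>M ^ (a + b + 2)\<close> against amplitude \<open>1 / M ^ (a + b + 1)\<close>: every term other than the
  principal one loses at least one factor \<open>M\<close>.\<close>
lemma scale_exponents:
  fixes a b i k :: nat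
  assumes "i + k < a + b \<or> (i + k = a + b \<and> k < a)"
  shows "Suc ((a + b + 2) * k + (a + b + 1) * i) \<le> (a + b + 2) * a + (a + b + 1) * b"
proof -
  let ?s = "a + b"
  have eq: "(?s + 2) * k + (?s + 1) * i = (?s + 1) * (i + k) + k"
    "(?s + 2) * a + (?s + 1) * b = (?s + 1) * ?s + a" by (simp_all add: algebra_simps)
  from assms show ?thesis
  proof
    assume "i + k < ?s"
    then have "(?s + 1) * Suc (i + k) \<le> (?s + 1) * ?s" by (intro mult_le_mono2) simp
    moreover have "Suc k \<le> ?s + 1" using \<open>i + k < ?s\<close> by simp
    ultimately show ?thesis unfolding eq by simp
  next
    assume "i + k = ?s \<and> k < a"
    then have "i + k = ?s" "k < a" by auto
    show ?thesis unfolding eq \<open>i + k = ?s\<close> using \<open>k < a\<close> by simp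
  qed
qed

text \<open>In the expansion of a derivative of order \<open>a + b\<close>, terms with
  \<open>i + k > a + b\<close> have coefficient zero, terms below \<open>(b, a)\<close> in the scale
  are small everywhere, and terms with \<open>k > a\<close> vanish near the new graph because the
  profile is polynomial in the phase there. The term \<open>(b, a)\<close> remains; its coefficient
  is the principal symbol, which is free of the slopes of \<open>Y\<close> when \<open>y\<close>
  occurs at least \<open>b\<close> times.\<close>

lemma oscillation_step:
  fixes y w :: "'a::euclidean_space" and c :: "'a \<Rightarrow> 'b::real_normed_vector"
  assumes y: "y \<in> Basis" and Y: "graph_fun \<eta> y Y" and c: "smooth c" and B: "compact B"
    and c0: "\<And>x. x \<notin> B \<Longrightarrow> c x = 0"
    and \<eta>: "smooth \<eta>" "\<And>x. x \<in> B \<Longrightarrow> \<eta> x = 1" "\<And>x. \<bar>\<eta> x\<bar> \<le> 1" "\<And>x t. \<eta> (x + t *\<^sub>R y) = \<eta> x"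
    and w: "w \<bullet> y = 0" and \<epsilon>: "\<epsilon> > 0"
  obtains Y' h \<delta> where "graph_fun \<eta> y Y'" "\<And>x. \<bar>Y' x - Y x\<bar> < \<epsilon>" "smooth h" "\<And>x. x \<notin> B \<Longrightarrow> h x = 0"
    "\<delta> > (0::real)"
    "\<And>vs x. set vs \<subseteq> Basis \<Longrightarrow> length vs < a + b \<Longrightarrow> norm (iter_pd vs h x) < \<epsilon>"
    "\<And>vs x. set vs \<subseteq> Basis \<Longrightarrow> length vs = a + b \<Longrightarrow> b \<le> count_list vs y \<Longrightarrow> \<bar>x \<bullet> y - Y' x\<bar> < \<delta> \<Longrightarrow>
       norm (iter_pd vs h x - (if count_list vs y = b then monomial_weight y w vs else 0) *\<^sub>R c x) < \<epsilon>"
proof -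
  obtain P :: "nat \<Rightarrow> nat \<Rightarrow> real \<Rightarrow> real \<Rightarrow> real"
  where P: "\<And>i k. continuous_on UNIV (\<lambda>z. P i k (fst z) (snd z))"
    "\<And>i k. \<exists>C. \<forall>u v. \<bar>P i k u v\<bar> \<le> C"
    "\<And>i k e f g df dg (x::'a::euclidean_space). has_dderiv e f df x \<Longrightarrow> has_dderiv e g dg x \<Longrightarrow>
       has_dderiv e (\<lambda>x. P i k (f x) (g x)) (df * P i (Suc k) (f x) (g x) + dg * P (Suc i) k (f x) (g x)) x"
    and P_top0: "\<And>i k u v. \<bar>v - sin u\<bar> < 1/8 \<Longrightarrow> k > a \<Longrightarrow> P i k u v = 0"
    and P_top1: "\<And>u v. \<bar>v - sin u\<bar> < 1/8 \<Longrightarrow> P b a u v = 1"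
    by (rule profile_exists) (rule that)
  have sY: "smooth Y" using Y by (simp add: graph_fun_def)
  interpret oscillation P y w Y c
    by unfold_locales (rule P sY c, assumption?, assumption?)+
  define s where "s = a + b"
  define R where "R = Suc (Suc s)"
  \<comment> \<open>One bound for all terms, fixed before the frequency is chosen: finitely many
    lists and indices occur, the profile is bounded, and the coefficients have compact support
    because \<open>c\<close> does.\<close>
  have "\<exists>K. \<forall>vs i k. set vs \<subseteq> Basis \<and> length vs \<le> s \<and> i < R \<and> k < R \<longrightarrow>
     (\<forall>u v x. \<bar>P i k u v\<bar> * norm (osc_coeff vs i k x) \<le> K)"
  proof -
    let ?F = "{vs::'a list. set vs \<subseteq> Basis \<and> length vs \<le> s} \<times> {..<R} \<times> {..<R}"
    have fin: "finite ?F" by (intro finite_cartesian_product finite_lists_length_le finite_Basis finite_lessThan)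
    have "\<exists>K\<ge>0. \<forall>u v x. \<bar>P i k u v\<bar> * norm (osc_coeff vs i k x) \<le> K" if vs: "set vs \<subseteq> Basis" for vs i k
    proof -
      obtain C where C: "\<And>u v. \<bar>P i k u v\<bar> \<le> C" using P(2) by blast
      obtain D where D: "\<And>x. norm (osc_coeff vs i k x) \<le> D"
        using bounded_of_compact_support[OF smooth_continuous[OF smooth_coeff[OF vs]] B]
          expansion_coeff_outside[of B c, OF _ c0] compact_imp_closed[OF B] by blast
      have "C \<ge> 0" "D \<ge> 0" using C[of 0 0] D[of 0] norm_ge_zero[of "osc_coeff vs i k 0"] by linarith+
      moreover have "\<bar>P i k u v\<bar> * norm (osc_coeff vs i k x) \<le> C * D" for u v x
        using C D \<open>C \<ge> 0\<close> by (intro mult_mono) auto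
      ultimately show ?thesis by (intro exI[of _ "C * D"]) auto
    qed
    then obtain Kf where Kf: "\<And>vs i k. set vs \<subseteq> Basis \<Longrightarrow> Kf vs i k \<ge> 0"
      "\<And>vs i k u v x. set vs \<subseteq> Basis \<Longrightarrow> \<bar>P i k u v\<bar> * norm (osc_coeff vs i k x) \<le> Kf vs i k"
      by metis
    let ?K = "\<Sum>(vs, i, k)\<in>?F. Kf vs i k"
    have le: "Kf vs i k \<le> ?K" if "set vs \<subseteq> Basis" "length vs \<le> s" "i < R" "k < R" for vs i k
      using member_le_sum[of "(vs, i, k)" ?F "\<lambda>(vs, i, k). Kf vs i k"] fin that Kf(1) by auto
    show ?thesis
      by (rule exI[of _ ?K]) (intro allI impI order_trans[OF Kf(2) le]; simp)
  qed
  then obtain K where K: "\<And>vs i k u v x. set vs \<subseteq> Basis \<Longrightarrow> length vs \<le> s \<Longrightarrow> i < R \<Longrightarrow> k < R \<Longrightarrow>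
     \<bar>P i k u v\<bar> * norm (osc_coeff vs i k x) \<le> K" by blast
  have K0: "K \<ge> 0" using order_trans[OF _ K[of "[]" 0 0 0 0 0]] by (simp add: R_def)
  \<comment> \<open>\<open>M\<close> has to beat the \<open>R * R\<close> terms of size
    \<open>K / M\<close> as well as the shift \<open>1 / M\<close> of the graph.\<close>
  obtain M' :: nat where M': "real M' > (R * R * K + 1) / \<epsilon> + 1" using reals_Archimedean2 by blast
  define M where "M = real M'"
  have Mbig: "M > (R * R * K + 1) / \<epsilon> + 1" using M' by (simp add: M_def)
  have "(R * R * K + 1) / \<epsilon> \<ge> 0" using K0 \<epsilon> by simp
  with Mbig have M1: "M > 1" by linarith
  have "(R * R * K + 1) / \<epsilon> < M" using Mbig by linarith
  then have M\<epsilon>: "R * R * (K / M) < \<epsilon>" "1 / M < \<epsilon>"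
    using \<epsilon> M1 K0 by (auto simp: field_simps) (smt (verit) mult_nonneg_nonneg of_nat_0_le_iff)
  define N where "N = M ^ (s + 2)"
  define dl where "dl = M ^ (s + 1)"
  \<comment> \<open>Normalises the scale factor \<open>A * N ^ a * dl ^ b\<close> of the principal
    term to \<open>1\<close>.\<close>
  define A where "A = inverse (M ^ ((s + 2) * a + (s + 1) * b))"
  have pos: "N > 0" "dl > 0" "A > 0" unfolding N_def dl_def A_def using M1 by auto
  have AN: "A * N ^ k * dl ^ i = M ^ ((s + 2) * k + (s + 1) * i) / M ^ ((s + 2) * a + (s + 1) * b)" for i k
  proof -
    have "N ^ k = M ^ ((s + 2) * k)" "dl ^ i = M ^ ((s + 1) * i)"
      unfolding N_def dl_def by (simp_all only: power_mult)
    then show ?thesis by (simp add: A_def power_add divide_inverse)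
  qed
  have A_small: "A * N ^ k * dl ^ i \<le> 1 / M" if "i + k < s \<or> (i + k = s \<and> k < a)" for i k
  proof -
    have "Suc ((s + 2) * k + (s + 1) * i) \<le> (s + 2) * a + (s + 1) * b"
      using scale_exponents that unfolding s_def by blast
    then have "M ^ Suc ((s + 2) * k + (s + 1) * i) \<le> M ^ ((s + 2) * a + (s + 1) * b)"
      using M1 by (intro power_increasing) auto
    then show ?thesis unfolding AN using M1 by (simp add: field_simps)
  qed
  have A_one: "A * N ^ a * dl ^ b = 1" unfolding AN using M1 by simp
  define h where "h x = wave A N dl 0 0 x *\<^sub>R c x" for x
  \<comment> \<open>Where \<eta> is \<open>1\<close>, in particular on the support of
    \<open>c\<close>, this is the curve \<open>v = sin u\<close> of the profile in the original
    coordinates.\<close>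
  define Y' where "Y' x = Y x + (1 / dl * sin (N * (w \<bullet> x))) * \<eta> x" for x
  have h_pd: "iter_pd vs h x = (\<Sum>(i,k)\<in>{..<R}\<times>{..<R}. wave A N dl i k x *\<^sub>R osc_coeff vs i k x)"
    if "set vs \<subseteq> Basis" "length vs \<le> s" for vs x
  proof -
    have "length vs < R" using that(2) by (simp add: R_def)
    then show ?thesis
      using iter_pd_wave[OF that(1), of R A N dl] by (simp add: h_def[abs_def] sum.cartesian_product)
  qed
  have term_le: "norm (wave A N dl i k x *\<^sub>R osc_coeff vs i k x) \<le> K / M"
    if "set vs \<subseteq> Basis" "length vs \<le> s" "i < R" "k < R" "i + k < s \<or> (i + k = s \<and> k < a)" for i k vs x
  proof -
    let ?q = "A * N ^ k * dl ^ i" and ?P = "P i k (N * (w \<bullet> x)) (dl * (x \<bullet> y - Y x))"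
    have "?q \<ge> 0" using pos by simp
    then have "norm (wave A N dl i k x *\<^sub>R osc_coeff vs i k x) = ?q * (\<bar>?P\<bar> * norm (osc_coeff vs i k x))"
      unfolding wave_def using pos by (simp add: abs_mult)
    also have "\<dots> \<le> 1 / M * K"
      using A_small that K pos K0 M1 by (intro mult_mono) auto
    finally show ?thesis by simp
  qed
  have "smooth (\<lambda>x. 1 / dl * sin (N * (w \<bullet> x)))"
    by (rule smooth_mult[OF smooth_const smooth_compose[OF smooth_sin smooth_linear]])
      (intro bounded_linear_intros)
  then have sY': "smooth Y'"
    unfolding Y'_def[abs_def] by (intro smooth_add[OF sY smooth_mult[OF _ \<eta>(1)]])
  have Y'_flat: "Y' (x + t *\<^sub>R y) = Y' x" for x t
  proof -
    have "Y (x + t *\<^sub>R y) = Y x" using Y unfolding graph_fun_def by blast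
    then show ?thesis unfolding Y'_def using \<eta>(4) w by (simp add: inner_add_right)
  qed
  show thesis
  \<comment> \<open>The strip of half-width \<open>1/8\<close> around the sine curve, scaled back by
    \<open>dl\<close>.\<close>
  proof (rule that[of Y' h "1 / (8 * dl)"], goal_cases)
    case 1
    show ?case using sY' Y'_flat Y by (auto simp: graph_fun_def Y'_def)
  next
    case (2 x)
    have "\<bar>Y' x - Y x\<bar> = 1 / dl * (\<bar>sin (N * (w \<bullet> x))\<bar> * \<bar>\<eta> x\<bar>)"
      using pos by (simp add: Y'_def abs_mult)
    also have "\<dots> \<le> 1 / dl * (1 * 1)"
      using pos \<eta>(3) by (intro mult_mono) auto
    also have "\<dots> \<le> 1 / M"
      using M1 power_increasing[of 1 "s + 1" M] by (simp add: dl_def frac_le)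
    finally show ?case using M\<epsilon>(2) by simp
  next
    case 3
    show ?case unfolding h_def[abs_def] by (rule smooth_scaleR[OF smooth_wave c])
  next
    case (4 x)
    then show ?case using c0 by (simp add: h_def)
  next
    case 5
    show ?case using pos by simp
  next
    case (6 vs x)
    have "norm (iter_pd vs h x) \<le> (\<Sum>(i,k)\<in>{..<R}\<times>{..<R}. K / M)"
      unfolding h_pd[OF 6(1) less_imp_le[OF 6(2)[folded s_def]]]
    proof (rule sum_norm_le, clarify)
      fix i k assume "i < R" "k < R"
      then show "norm (wave A N dl i k x *\<^sub>R osc_coeff vs i k x) \<le> K / M"
        using term_le[of vs i k x] 6 K0 M1
        by (cases "i + k < s") (auto simp: s_def expansion_coeff_degree)
    qed
    then show ?case using M\<epsilon>(1) by simp
  next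
    case (7 vs x)
    have main: "norm (iter_pd vs h x - osc_coeff vs b a x) < \<epsilon>"
    proof (cases "x \<in> B")
      case False
      then have "osc_coeff vs i k x = 0" for i k
        using expansion_coeff_outside[of B c x] c0 compact_imp_closed[OF B] by simp
      then show ?thesis using \<epsilon> h_pd[OF 7(1), of x] 7(2) by (simp add: s_def)
    next
      case True
      let ?u = "N * (w \<bullet> x)" and ?v = "dl * (x \<bullet> y - Y x)"
      have "?v - sin ?u = dl * (x \<bullet> y - Y' x)"
        using \<eta>(2)[OF True] pos by (simp add: Y'_def field_simps)
      then have "\<bar>?v - sin ?u\<bar> = dl * \<bar>x \<bullet> y - Y' x\<bar>" using pos by (simp add: abs_mult)
      also have "\<dots> < dl * (1 / (8 * dl))" using 7(4) pos by (intro mult_strict_left_mono)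
      finally have near: "\<bar>?v - sin ?u\<bar> < 1/8" using pos by simp
      have "(\<Sum>(i,k)\<in>{..<R}\<times>{..<R}. if (i,k) = (b,a) then osc_coeff vs b a x else 0)
          = (\<Sum>p\<in>{..<R}\<times>{..<R}. if p = (b,a) then osc_coeff vs b a x else 0)"
        by (rule sum.cong[OF refl]) (simp add: split_beta prod_eq_iff)
      also have "\<dots> = osc_coeff vs b a x"
        by (subst sum.delta) (auto simp: s_def R_def)
      finally have "osc_coeff vs b a x =
          (\<Sum>(i,k)\<in>{..<R}\<times>{..<R}. if (i,k) = (b,a) then osc_coeff vs b a x else 0)" ..
      then have "norm (iter_pd vs h x - osc_coeff vs b a x) =
        norm (\<Sum>(i,k)\<in>{..<R}\<times>{..<R}. wave A N dl i k x *\<^sub>R osc_coeff vs i k x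
          - (if (i,k) = (b,a) then osc_coeff vs b a x else 0))"
        unfolding h_pd[OF 7(1) eq_imp_le[OF 7(2)[folded s_def]]]
        by (simp add: sum_subtractf case_prod_unfold)
      also have "\<dots> \<le> (\<Sum>(i,k)\<in>{..<R}\<times>{..<R}. K / M)"
      proof (rule sum_norm_le, clarify)
        fix i k assume ik: "i < R" "k < R"
        \<comment> \<open>Exhaustive because \<open>i + k = s\<close> and \<open>k = a\<close> force
          \<open>i = b\<close>. In the first case the term equals its limit exactly, in the next two
          it is zero, and only the last one needs the scaling.\<close>
        consider "i = b" "k = a" | "(i,k) \<noteq> (b,a)" "k > a" | "(i,k) \<noteq> (b,a)" "i + k > s"
          | "i + k < s \<or> (i + k = s \<and> k < a)"
          by (auto simp: s_def) linarith
        then show "norm (wave A N dl i k x *\<^sub>R osc_coeff vs i k x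
            - (if (i,k) = (b,a) then osc_coeff vs b a x else 0)) \<le> K / M"
        proof cases
          case 1
          then show ?thesis using A_one P_top1[OF near] K0 M1 by (simp add: wave_def)
        next
          case 2
          then show ?thesis using P_top0[OF near] K0 M1 by (auto simp: wave_def)
        next
          case 3
          then show ?thesis using K0 M1 7 by (auto simp: s_def expansion_coeff_degree)
        next
          case 4
          then have "(i,k) \<noteq> (b,a)" by (auto simp: s_def)
          then show ?thesis using term_le[of vs i k x] 4 7 ik by (auto simp: s_def)
        qed
      qed
      finally show ?thesis using M\<epsilon>(1) by simp
    qed
    have "slope y x = 1" for x
      using graph_fun_dderiv[OF Y] y by (simp add: slope_def)
    then have "osc_coeff vs b a x = (if count_list vs y = b then monomial_weight y w vs *\<^sub>R c x else 0)"
      using 7 w by (intro expansion_coeff_symbol) auto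
    then show ?case using main by (simp split: if_splits)
  qed
qed

section \<open>Inductive correction of the jet\<close>

lemma iter_pd_zero: "iter_pd vs (\<lambda>x. 0) = (\<lambda>x. 0)"
  by (induction vs) (simp_all add: dderiv_zero)

text \<open>Superposes several oscillations of the same type \<open>(a, b)\<close>. Each is built
  over the graph left by the one before, and their principal parts add up.\<close>

lemma oscillation_steps:
  fixes y :: "'a::euclidean_space" and qs :: "('a \<times> ('a \<Rightarrow> 'b::real_normed_vector)) list"
  assumes y: "y \<in> Basis" and Y: "graph_fun \<eta> y Y" and B: "compact B"
    and qs: "\<And>w c. (w, c) \<in> set qs \<Longrightarrow> w \<bullet> y = 0 \<and> smooth c \<and> (\<forall>x. x \<notin> B \<longrightarrow> c x = 0)"
    and \<eta>: "smooth \<eta>" "\<And>x. x \<in> B \<Longrightarrow> \<eta> x = 1" "\<And>x. \<bar>\<eta> x\<bar> \<le> 1" "\<And>x t. \<eta> (x + t *\<^sub>R y) = \<eta> x"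
    and \<epsilon>: "\<epsilon> > 0"
  shows "\<exists>Y' h \<delta>. graph_fun \<eta> y Y' \<and> (\<forall>x. \<bar>Y' x - Y x\<bar> < \<epsilon>) \<and> smooth h \<and> (\<forall>x. x \<notin> B \<longrightarrow> h x = 0) \<and>
    \<delta> > (0::real) \<and>
    (\<forall>vs x. set vs \<subseteq> Basis \<longrightarrow> length vs < a + b \<longrightarrow> norm (iter_pd vs h x) < \<epsilon>) \<and>
    (\<forall>vs x. set vs \<subseteq> Basis \<longrightarrow> length vs = a + b \<longrightarrow> b \<le> count_list vs y \<longrightarrow> \<bar>x \<bullet> y - Y' x\<bar> < \<delta> \<longrightarrow>
       norm (iter_pd vs h x -
         (\<Sum>(w, c)\<leftarrow>qs. (if count_list vs y = b then monomial_weight y w vs else 0) *\<^sub>R c x)) < \<epsilon>)"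
  using qs Y \<epsilon>
proof (induction qs arbitrary: Y \<epsilon>)
  case Nil
  then show ?case
    by (intro exI[of _ Y] exI[of _ "\<lambda>x. 0"] exI[of _ 1]) (simp add: smooth_const iter_pd_zero)
next
  case (Cons q qs)
  obtain w c where q: "q = (w, c)" by (cases q)
  have wc: "w \<bullet> y = 0" "smooth c" "\<And>x. x \<notin> B \<Longrightarrow> c x = 0" using Cons.prems(1)[of w c] q by auto
  have "\<epsilon> / 2 > 0" using Cons.prems by simp
  obtain Y1 h1 \<delta>1 where 1: "graph_fun \<eta> y Y1" "\<And>x. \<bar>Y1 x - Y x\<bar> < \<epsilon>/2" "smooth h1" "\<And>x. x \<notin> B \<Longrightarrow> h1 x = 0"
    "\<delta>1 > (0::real)"
    "\<And>vs x. set vs \<subseteq> Basis \<Longrightarrow> length vs < a + b \<Longrightarrow> norm (iter_pd vs h1 x) < \<epsilon>/2"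
    "\<And>vs x. set vs \<subseteq> Basis \<Longrightarrow> length vs = a + b \<Longrightarrow> b \<le> count_list vs y \<Longrightarrow> \<bar>x \<bullet> y - Y1 x\<bar> < \<delta>1 \<Longrightarrow>
       norm (iter_pd vs h1 x - (if count_list vs y = b then monomial_weight y w vs else 0) *\<^sub>R c x) < \<epsilon>/2"
    by (rule oscillation_step[OF y Cons.prems(2) wc(2) B wc(3) \<eta> wc(1) \<open>\<epsilon> / 2 > 0\<close>, of a b]) (assumption | rule that)+
  \<comment> \<open>With later shifts below \<open>\<delta>1/2\<close>, the tube of radius
    \<open>\<delta>1/2\<close> around the final graph lies inside the tube where the first
    oscillation is controlled.\<close>
  define \<epsilon>' where "\<epsilon>' = min (\<epsilon>/2) (\<delta>1/2)"
  have "\<epsilon>' > 0" using \<open>\<epsilon> / 2 > 0\<close> 1(5) by (simp add: \<epsilon>'_def)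
  have "\<exists>Y' h \<delta>. graph_fun \<eta> y Y' \<and> (\<forall>x. \<bar>Y' x - Y1 x\<bar> < \<epsilon>') \<and> smooth h \<and> (\<forall>x. x \<notin> B \<longrightarrow> h x = 0) \<and>
    \<delta> > (0::real) \<and>
    (\<forall>vs x. set vs \<subseteq> Basis \<longrightarrow> length vs < a + b \<longrightarrow> norm (iter_pd vs h x) < \<epsilon>') \<and>
    (\<forall>vs x. set vs \<subseteq> Basis \<longrightarrow> length vs = a + b \<longrightarrow> b \<le> count_list vs y \<longrightarrow> \<bar>x \<bullet> y - Y' x\<bar> < \<delta> \<longrightarrow>
       norm (iter_pd vs h x -
         (\<Sum>(w, c)\<leftarrow>qs. (if count_list vs y = b then monomial_weight y w vs else 0) *\<^sub>R c x)) < \<epsilon>')"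
    by (rule Cons.IH[OF _ 1(1) \<open>\<epsilon>' > 0\<close>], rule Cons.prems(1)) simp
  then obtain Y2 h2 \<delta>2 where 2: "graph_fun \<eta> y Y2" "\<And>x. \<bar>Y2 x - Y1 x\<bar> < \<epsilon>'" "smooth h2" "\<And>x. x \<notin> B \<Longrightarrow> h2 x = 0"
    "\<delta>2 > (0::real)"
    "\<And>vs x. set vs \<subseteq> Basis \<Longrightarrow> length vs < a + b \<Longrightarrow> norm (iter_pd vs h2 x) < \<epsilon>'"
    "\<And>vs x. set vs \<subseteq> Basis \<Longrightarrow> length vs = a + b \<Longrightarrow> b \<le> count_list vs y \<Longrightarrow> \<bar>x \<bullet> y - Y2 x\<bar> < \<delta>2 \<Longrightarrow>
       norm (iter_pd vs h2 x -
         (\<Sum>(w, c)\<leftarrow>qs. (if count_list vs y = b then monomial_weight y w vs else 0) *\<^sub>R c x)) < \<epsilon>'"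
    by (elim exE conjE) (rule that; blast)
  have le: "\<epsilon>' \<le> \<epsilon>/2" "\<epsilon>' \<le> \<delta>1/2" by (auto simp: \<epsilon>'_def)
  let ?h = "\<lambda>x. h1 x + h2 x"
  have pd: "iter_pd vs ?h x = iter_pd vs h1 x + iter_pd vs h2 x" if "set vs \<subseteq> Basis" for vs x
    using iter_pd_add[OF 1(3) 2(3) that] by simp
  show ?case
  proof (intro exI[of _ Y2] exI[of _ ?h] exI[of _ "min \<delta>2 (\<delta>1/2)"] conjI allI impI)
    show "graph_fun \<eta> y Y2" by fact
    show "\<bar>Y2 x - Y x\<bar> < \<epsilon>" for x using 1(2)[of x] 2(2)[of x] le by linarith
    show "smooth ?h" by (rule smooth_add[OF 1(3) 2(3)])
    show "?h x = 0" if "x \<notin> B" for x using that 1 2 by simp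
    show "min \<delta>2 (\<delta>1/2) > 0" using 1 2 by simp
  next
    fix vs :: "'a list" and x assume "set vs \<subseteq> Basis" "length vs < a + b"
    then have "norm (iter_pd vs h1 x) < \<epsilon>/2" "norm (iter_pd vs h2 x) < \<epsilon>'" using 1 2 by auto
    then show "norm (iter_pd vs ?h x) < \<epsilon>"
      using pd[OF \<open>set vs \<subseteq> Basis\<close>] le norm_triangle_ineq[of "iter_pd vs h1 x" "iter_pd vs h2 x"] by simp
  next
    fix vs :: "'a list" and x
    assume vs: "set vs \<subseteq> Basis" "length vs = a + b" "b \<le> count_list vs y"
      and near: "\<bar>x \<bullet> y - Y2 x\<bar> < min \<delta>2 (\<delta>1/2)"
    have "\<bar>x \<bullet> y - Y1 x\<bar> < \<delta>1" using near 2(2)[of x] le by linarith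
    from 1(7)[OF vs this]
    have A: "norm (iter_pd vs h1 x - (if count_list vs y = b then monomial_weight y w vs else 0) *\<^sub>R c x) < \<epsilon>/2"
      (is "norm (_ - ?A) < _") .
    have "norm (iter_pd vs h2 x -
         (\<Sum>(w, c)\<leftarrow>qs. (if count_list vs y = b then monomial_weight y w vs else 0) *\<^sub>R c x)) < \<epsilon>'"
      (is "norm (_ - ?S) < _")
      using near by (intro 2(7)[OF vs]) simp
    then have "norm (iter_pd vs h1 x - ?A) + norm (iter_pd vs h2 x - ?S) < \<epsilon>" using A le by linarith
    then have "norm ((iter_pd vs h1 x - ?A) + (iter_pd vs h2 x - ?S)) < \<epsilon>"
      using norm_triangle_ineq order_le_less_trans by blast
    then show "norm (iter_pd vs ?h x -
       (\<Sum>(w, c)\<leftarrow>q # qs. (if count_list vs y = b then monomial_weight y w vs else 0) *\<^sub>R c x)) < \<epsilon>"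
      unfolding pd[OF vs(1)] q by (simp add: algebra_simps)
  qed
qed

text \<open>The functional is the \<open>n\<close>-th forward difference at \<open>0\<close> divided
  by \<open>n!\<close>: it annihilates lower powers and takes the \<open>n\<close>-th power to
  \<open>1\<close>.\<close>

lemma top_power_functional_exists:
  "\<exists>d::nat \<Rightarrow> real. \<forall>k\<le>n. (\<Sum>i\<le>n. d i * real i ^ k) = (if k = n then 1 else 0)"
proof (induction n)
  case 0
  show ?case by (intro exI[of _ "\<lambda>i. 1"]) simp
next
  case (Suc n)
  then obtain d :: "nat \<Rightarrow> real" where d: "\<And>k. k \<le> n \<Longrightarrow> (\<Sum>i\<le>n. d i * real i ^ k) = (if k = n then 1 else 0)"
    by blast
  \<comment> \<open>The previous functional applied to the difference
    \<open>(i + 1) ^ k - i ^ k\<close>, divided by \<open>n + 1\<close>.\<close>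
  let ?d = "\<lambda>i. ((if i = 0 then 0 else d (i - 1)) - (if i \<le> n then d i else 0)) / real (Suc n)"
  have "(\<Sum>i\<le>Suc n. ?d i * real i ^ k) = (if k = Suc n then 1 else 0)" if k: "k \<le> Suc n" for k
  proof -
    have bin: "real (Suc i) ^ k - real i ^ k = (\<Sum>t<k. real (k choose t) * real i ^ t)" for i
    proof -
      have "real (Suc i) ^ k = (\<Sum>t\<le>k. real (k choose t) * real i ^ t)"
        using binomial_ring[of "real i" 1 k] by (simp add: add.commute)
      then show ?thesis by (simp add: lessThan_Suc_atMost[symmetric])
    qed
    have "real (Suc n) * (\<Sum>i\<le>Suc n. ?d i * real i ^ k)
        = (\<Sum>i\<le>Suc n. (if i = 0 then 0 else d (i - 1)) * real i ^ k)
        - (\<Sum>i\<le>Suc n. (if i \<le> n then d i else 0) * real i ^ k)"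
      unfolding sum_distrib_left sum_subtractf[symmetric]
      by (intro sum.cong) (simp_all add: field_simps)
    also have "(\<Sum>i\<le>Suc n. (if i = 0 then 0 else d (i - 1)) * real i ^ k) = (\<Sum>i\<le>n. d i * real (Suc i) ^ k)"
      by (subst sum.atMost_Suc_shift) simp
    also have "(\<Sum>i\<le>Suc n. (if i \<le> n then d i else 0) * real i ^ k) = (\<Sum>i\<le>n. d i * real i ^ k)"
      by (simp add: sum.atMost_Suc)
    also have "(\<Sum>i\<le>n. d i * real (Suc i) ^ k) - (\<Sum>i\<le>n. d i * real i ^ k)
        = (\<Sum>i\<le>n. d i * (\<Sum>t<k. real (k choose t) * real i ^ t))"
      unfolding sum_subtractf[symmetric] bin[symmetric] by (simp add: algebra_simps)
    also have "\<dots> = (\<Sum>t<k. real (k choose t) * (\<Sum>i\<le>n. d i * real i ^ t))"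
      unfolding sum_distrib_left by (subst sum.swap) (simp add: algebra_simps)
    also have "\<dots> = (\<Sum>t<k. if t = n then real (k choose n) else 0)"
      using k by (intro sum.cong) (auto simp: d)
    also have "\<dots> = real (Suc n) * (if k = Suc n then 1 else 0)"
      using k by (cases "k = Suc n") (auto simp: sum.delta)
    finally show ?thesis by (rule mult_left_cancel[THEN iffD1, rotated]) simp
  qed
  then show ?case by (intro exI[of _ ?d] allI impI)
qed

section \<open>Multi-indices as lists of basis vectors\<close>

definition mlist :: "('m::finite \<Rightarrow> nat) \<Rightarrow> (real^'m) list" where
  "mlist \<alpha> = concat (map (\<lambda>i. replicate (\<alpha> i) (axis i 1)) coord_enum)"

lemma mpderiv_mlist: "mpderiv \<alpha> f = iter_pd (mlist \<alpha>) f"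
  by (simp add: mpderiv_def mlist_def)

lemma coord_enum: "distinct (coord_enum :: 'm::finite list)" "set (coord_enum :: 'm list) = UNIV"
proof -
  have "\<exists>xs::'m list. distinct xs \<and> set xs = UNIV"
    using finite_distinct_list[of "UNIV :: 'm set"] by auto
  then have "distinct (coord_enum :: 'm list) \<and> set (coord_enum :: 'm list) = UNIV"
    unfolding coord_enum_def by (rule someI_ex)
  then show "distinct (coord_enum :: 'm list)" "set (coord_enum :: 'm list) = UNIV" by auto
qed

lemma set_mlist: "set (mlist \<alpha>) \<subseteq> Basis"
  by (auto simp: mlist_def)

lemma length_mlist: "length (mlist \<alpha>) = mdeg \<alpha>"
proof -
  have "length (mlist \<alpha>) = sum_list (map \<alpha> coord_enum)"
    by (simp add: mlist_def length_concat o_def)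
  then show ?thesis
    using sum.distinct_set_conv_list[OF coord_enum(1), of \<alpha>] by (simp add: mdeg_def coord_enum(2))
qed

lemma count_list_replicate: "count_list (replicate n x) z = (if x = z then n else 0)"
  by (induction n) auto

lemma count_mlist: "count_list (mlist \<alpha>) (axis j 1) = \<alpha> j"
proof -
  have "distinct xs \<Longrightarrow> count_list (concat (map (\<lambda>i. replicate (\<alpha> i) (axis i (1::real))) xs)) (axis j 1)
      = (if j \<in> set xs then \<alpha> j else 0)" for xs
    by (induction xs) (auto simp: count_list_replicate axis_eq_axis)
  then show ?thesis using coord_enum[where 'm = 'a] by (simp add: mlist_def)
qed

lemma monomial_weight_mlist:
  "monomial_weight (axis j 1) w (mlist \<alpha>) = (\<Prod>i\<in>UNIV - {j}. (w $ i) ^ \<alpha> i)"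
proof -
  have app: "monomial_weight y w (us @ vs) = monomial_weight y w us * monomial_weight y w vs" for y us vs
    by (simp add: monomial_weight_def)
  have rep: "monomial_weight (axis j 1) w (replicate n (axis i 1)) = (if i = j then 1 else (w $ i) ^ n)" for i n
    by (simp add: monomial_weight_def filter_replicate axis_eq_axis inner_axis)
  have "distinct xs \<Longrightarrow> monomial_weight (axis j 1) w (concat (map (\<lambda>i. replicate (\<alpha> i) (axis i 1)) xs))
      = (\<Prod>i\<in>set xs - {j}. (w $ i) ^ \<alpha> i)" for xs
  proof (induction xs)
    case Nil
    then show ?case by (simp add: monomial_weight_def)
  next
    case (Cons i xs)
    then show ?case by (auto simp: app rep insert_Diff_if)
  qed
  then show ?thesis using coord_enum[where 'm = 'a] by (simp add: mlist_def)
qed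

lemma le_mdeg: "\<alpha> i \<le> mdeg \<alpha>"
  unfolding mdeg_def by (rule member_le_sum) auto

lemma finite_mdeg_le: "finite {\<alpha>::'m::finite \<Rightarrow> nat. mdeg \<alpha> \<le> s}"
proof (rule finite_subset)
  show "finite (PiE (UNIV :: 'm set) (\<lambda>_. {..s}))" by (rule finite_PiE) auto
  show "{\<alpha>. mdeg \<alpha> \<le> s} \<subseteq> PiE (UNIV :: 'm set) (\<lambda>_. {..s})"
    using le_mdeg by (auto intro: order_trans)
qed

text \<open>An oscillation with wave vector \<open>w\<close> produces all tangential monomials in
  \<open>w\<close> at once. To prescribe each \<tau> separately, oscillations over a finite grid of
  wave vectors are weighted so that all monomials but one cancel.\<close>

lemma realize_monomials:
  fixes \<tau> :: "('m::finite \<Rightarrow> nat) \<Rightarrow> real^'m \<Rightarrow> real^'n"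
  assumes Y: "graph_fun \<eta> (axis j 1) Y" and B: "compact B" and "b \<le> s"
    and \<tau>: "\<And>\<alpha>. mdeg \<alpha> = s \<Longrightarrow> \<alpha> j = b \<Longrightarrow> smooth (\<tau> \<alpha>)"
      "\<And>\<alpha> x. mdeg \<alpha> = s \<Longrightarrow> \<alpha> j = b \<Longrightarrow> x \<notin> B \<Longrightarrow> \<tau> \<alpha> x = 0"
    and \<eta>: "smooth \<eta>" "\<And>x. x \<in> B \<Longrightarrow> \<eta> x = 1" "\<And>x. \<bar>\<eta> x\<bar> \<le> 1" "\<And>x t. \<eta> (x + t *\<^sub>R axis j 1) = \<eta> x"
    and \<epsilon>: "\<epsilon> > 0"
  shows "\<exists>Y' h \<delta>. graph_fun \<eta> (axis j 1) Y' \<and> (\<forall>x. \<bar>Y' x - Y x\<bar> < \<epsilon>) \<and> smooth h \<and>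
    (\<forall>x. x \<notin> B \<longrightarrow> h x = 0) \<and> \<delta> > (0::real) \<and>
    (\<forall>\<alpha> x. mdeg \<alpha> < s \<longrightarrow> norm (mpderiv \<alpha> h x) < \<epsilon>) \<and>
    (\<forall>\<alpha> x. mdeg \<alpha> = s \<longrightarrow> b \<le> \<alpha> j \<longrightarrow> \<bar>x $ j - Y' x\<bar> < \<delta> \<longrightarrow>
       norm (mpderiv \<alpha> h x - (if \<alpha> j = b then \<tau> \<alpha> x else 0)) < \<epsilon>)"
proof -
  obtain d :: "nat \<Rightarrow> nat \<Rightarrow> real" where
    d: "\<And>n k. k \<le> n \<Longrightarrow> (\<Sum>i\<le>n. d n i * real i ^ k) = (if k = n then 1 else 0)"
    using top_power_functional_exists by metis
  let ?J = "UNIV - {j}"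
  define A where "A = {\<alpha>::'m \<Rightarrow> nat. mdeg \<alpha> = s \<and> \<alpha> j = b}"
  \<comment> \<open>For each \<alpha> the grid of integer wave vectors \<nu> is bounded by \<alpha>
    and has no component along \<open>j\<close>. The weights \<open>cf\<close> are products of the
    one-variable functionals, so the sum over the grid factorises.\<close>
  define I where "I = Sigma A (\<lambda>\<alpha>. PiE ?J (\<lambda>i. {..\<alpha> i}))"
  define wt :: "('m \<Rightarrow> nat) \<Rightarrow> real^'m" where "wt \<nu> = (\<chi> i. if i = j then 0 else real (\<nu> i))" for \<nu>
  define cf where "cf \<alpha> \<nu> = (\<Prod>i\<in>?J. d (\<alpha> i) (\<nu> i))" for \<alpha> \<nu> :: "'m \<Rightarrow> nat"
  have finA: "finite A"
    by (rule finite_subset[OF _ finite_mdeg_le[of s]]) (auto simp: A_def)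
  have finI: "finite I" unfolding I_def by (intro finite_SigmaI finA finite_PiE) auto
  obtain ps where ps: "set ps = I" "distinct ps" using finite_distinct_list[OF finI] by blast
  define qs where "qs = map (\<lambda>(\<alpha>, \<nu>). (wt \<nu>, \<lambda>x. cf \<alpha> \<nu> *\<^sub>R \<tau> \<alpha> x)) ps"
  have qs: "w \<bullet> axis j 1 = 0 \<and> smooth c \<and> (\<forall>x. x \<notin> B \<longrightarrow> c x = 0)" if "(w, c) \<in> set qs" for w c
  proof -
    from that obtain \<alpha> \<nu> where "\<alpha> \<in> A" and wc: "w = wt \<nu>" "c = (\<lambda>x. cf \<alpha> \<nu> *\<^sub>R \<tau> \<alpha> x)"
      by (auto simp: qs_def ps I_def)
    moreover have "smooth (\<tau> \<alpha>)" "\<And>x. x \<notin> B \<Longrightarrow> \<tau> \<alpha> x = 0" using \<tau> \<open>\<alpha> \<in> A\<close> by (auto simp: A_def)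
    ultimately show ?thesis by (simp add: wt_def inner_axis smooth_scaleR[OF smooth_const])
  qed
  have orth: "(\<Sum>\<nu>\<in>PiE ?J (\<lambda>i. {..\<alpha> i}). cf \<alpha> \<nu> * (\<Prod>i\<in>?J. (wt \<nu> $ i) ^ \<beta> i)) = (if \<alpha> = \<beta> then 1 else 0)"
    if "\<alpha> \<in> A" "\<beta> \<in> A" for \<alpha> \<beta>
  proof -
    have "(\<Sum>\<nu>\<in>PiE ?J (\<lambda>i. {..\<alpha> i}). cf \<alpha> \<nu> * (\<Prod>i\<in>?J. (wt \<nu> $ i) ^ \<beta> i))
        = (\<Sum>\<nu>\<in>PiE ?J (\<lambda>i. {..\<alpha> i}). \<Prod>i\<in>?J. d (\<alpha> i) (\<nu> i) * real (\<nu> i) ^ \<beta> i)"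
      by (intro sum.cong) (auto simp: cf_def wt_def prod.distrib)
    also have "\<dots> = (\<Prod>i\<in>?J. \<Sum>t\<le>\<alpha> i. d (\<alpha> i) t * real t ^ \<beta> i)"
      by (subst prod_sum_PiE) auto
    also have "\<dots> = (if \<alpha> = \<beta> then 1 else 0)"
    proof (cases "\<alpha> = \<beta>")
      case True
      then show ?thesis by (simp add: d)
    next
      case False
      \<comment> \<open>The functionals vanish only on powers below their own. That is enough, since
        distinct multi-indices with equal degree and equal \<open>j\<close> entry cannot satisfy
        \<alpha> \<le> \<beta> everywhere.\<close>
      have "\<exists>i\<in>?J. \<beta> i < \<alpha> i"
      proof (rule ccontr)
        assume "\<not> (\<exists>i\<in>?J. \<beta> i < \<alpha> i)"
        then have le: "\<alpha> i \<le> \<beta> i" for i using that by (cases "i = j") (auto simp: A_def not_less)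
        from False obtain i where "\<alpha> i \<noteq> \<beta> i" by auto
        then have "\<alpha> i < \<beta> i" using le[of i] by simp
        then have "mdeg \<alpha> < mdeg \<beta>" unfolding mdeg_def using le by (intro sum_strict_mono_ex1) auto
        then show False using that by (simp add: A_def)
      qed
      then obtain i where "i \<in> ?J" "\<beta> i < \<alpha> i" by blast
      then have "(\<Sum>t\<le>\<alpha> i. d (\<alpha> i) t * real t ^ \<beta> i) = 0" by (subst d) auto
      then show ?thesis using False \<open>i \<in> ?J\<close> by (auto intro!: prod_zero)
    qed
    finally show ?thesis .
  qed
  have total: "(\<Sum>(w, c)\<leftarrow>qs. monomial_weight (axis j 1) w (mlist \<beta>) *\<^sub>R c x) = \<tau> \<beta> x" if "\<beta> \<in> A" for \<beta> x
  proof -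
    have "(\<Sum>(w, c)\<leftarrow>qs. monomial_weight (axis j 1) w (mlist \<beta>) *\<^sub>R c x)
      = (\<Sum>(\<alpha>, \<nu>)\<leftarrow>ps. (cf \<alpha> \<nu> * (\<Prod>i\<in>?J. (wt \<nu> $ i) ^ \<beta> i)) *\<^sub>R \<tau> \<alpha> x)"
      by (simp add: qs_def o_def case_prod_unfold monomial_weight_mlist mult.commute)
    also have "\<dots> = (\<Sum>(\<alpha>, \<nu>)\<in>I. (cf \<alpha> \<nu> * (\<Prod>i\<in>?J. (wt \<nu> $ i) ^ \<beta> i)) *\<^sub>R \<tau> \<alpha> x)"
      unfolding ps(1)[symmetric] by (rule sum.distinct_set_conv_list[OF ps(2), symmetric])
    also have "\<dots> = (\<Sum>\<alpha>\<in>A. \<Sum>\<nu>\<in>PiE ?J (\<lambda>i. {..\<alpha> i}). (cf \<alpha> \<nu> * (\<Prod>i\<in>?J. (wt \<nu> $ i) ^ \<beta> i)) *\<^sub>R \<tau> \<alpha> x)"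
      unfolding I_def by (rule sum.Sigma[symmetric]) (auto intro: finA finite_PiE)
    also have "\<dots> = (\<Sum>\<alpha>\<in>A. (if \<alpha> = \<beta> then 1 else 0) *\<^sub>R \<tau> \<alpha> x)"
      by (intro sum.cong refl) (simp add: scaleR_sum_left[symmetric] orth[OF _ that])
    also have "\<dots> = (\<Sum>\<alpha>\<in>A. if \<alpha> = \<beta> then \<tau> \<beta> x else 0)"
      by (intro sum.cong) auto
    also have "\<dots> = \<tau> \<beta> x" using finA that by (simp add: sum.delta)
    finally show ?thesis .
  qed
  have y: "axis j 1 \<in> (Basis :: (real^'m) set)" by simp
  obtain Y' h \<delta> where *: "graph_fun \<eta> (axis j 1) Y'" "\<forall>x. \<bar>Y' x - Y x\<bar> < \<epsilon>" "smooth h" "\<forall>x. x \<notin> B \<longrightarrow> h x = 0"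
    "\<delta> > (0::real)"
    and small: "\<And>vs x. set vs \<subseteq> Basis \<Longrightarrow> length vs < (s - b) + b \<Longrightarrow> norm (iter_pd vs h x) < \<epsilon>"
    and near: "\<And>vs x. set vs \<subseteq> Basis \<Longrightarrow> length vs = (s - b) + b \<Longrightarrow> b \<le> count_list vs (axis j 1) \<Longrightarrow>
       \<bar>x \<bullet> axis j 1 - Y' x\<bar> < \<delta> \<Longrightarrow> norm (iter_pd vs h x -
         (\<Sum>(w, c)\<leftarrow>qs. (if count_list vs (axis j 1) = b then monomial_weight (axis j 1) w vs else 0) *\<^sub>R c x)) < \<epsilon>"
    by (rule oscillation_steps[OF y Y B qs \<eta> \<epsilon>, where qs = qs and a = "s - b" and b = b, THEN exE],
        assumption, assumption, elim exE conjE) (rule that; blast)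
  show ?thesis
  proof (intro exI[of _ Y'] exI[of _ h] exI[of _ \<delta>] conjI * allI impI)
    fix \<alpha> :: "'m \<Rightarrow> nat" and x assume "mdeg \<alpha> < s"
    then show "norm (mpderiv \<alpha> h x) < \<epsilon>"
      using small[OF set_mlist] \<open>b \<le> s\<close> by (simp add: mpderiv_mlist length_mlist)
  next
    fix \<alpha> :: "'m \<Rightarrow> nat" and x assume \<alpha>: "mdeg \<alpha> = s" "b \<le> \<alpha> j" "\<bar>x $ j - Y' x\<bar> < \<delta>"
    have "norm (iter_pd (mlist \<alpha>) h x -
         (\<Sum>(w, c)\<leftarrow>qs. (if \<alpha> j = b then monomial_weight (axis j 1) w (mlist \<alpha>) else 0) *\<^sub>R c x)) < \<epsilon>"
      using near[OF set_mlist, of \<alpha> x] \<alpha> \<open>b \<le> s\<close> by (simp add: count_mlist length_mlist inner_axis)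
    moreover have "(\<Sum>(w, c)\<leftarrow>qs. (if \<alpha> j = b then monomial_weight (axis j 1) w (mlist \<alpha>) else 0) *\<^sub>R c x)
        = (if \<alpha> j = b then \<tau> \<alpha> x else 0)"
      using total[of \<alpha> x] \<alpha> by (auto simp: A_def case_prod_unfold)
    ultimately show "norm (mpderiv \<alpha> h x - (if \<alpha> j = b then \<tau> \<alpha> x else 0)) < \<epsilon>"
      by (simp add: mpderiv_mlist)
  qed
qed

section \<open>Induction on the order and on the number of factors dy\<close>

locale jet_target =
  fixes \<tau> :: "('m::finite \<Rightarrow> nat) \<Rightarrow> real^'m \<Rightarrow> real^'n"
    and j :: 'm and \<eta> :: "real^'m \<Rightarrow> real" and B :: "(real^'m) set" and l r :: nat
  assumes B: "compact B"
    and \<tau>_smooth: "\<And>\<alpha>. mdeg \<alpha> \<le> r \<Longrightarrow> smooth (\<tau> \<alpha>)"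
    and \<tau>_support: "\<And>\<alpha> x. mdeg \<alpha> \<le> r \<Longrightarrow> x \<notin> B \<Longrightarrow> \<tau> \<alpha> x = 0"
    and \<tau>_low: "\<And>\<alpha> x. mdeg \<alpha> \<le> l \<Longrightarrow> \<tau> \<alpha> x = 0"
    and \<eta>: "smooth \<eta>" "\<And>x. x \<in> B \<Longrightarrow> \<eta> x = 1" "\<And>x. \<bar>\<eta> x\<bar> \<le> 1" "\<And>x t. \<eta> (x + t *\<^sub>R axis j 1) = \<eta> x"
begin

text \<open>Progress is measured by \<open>s\<close> increasing and, for fixed \<open>s\<close>, by
  \<open>b\<close> decreasing. Smallness up to order \<open>l\<close> is required on the whole
  space, closeness to \<tau> only in the tube of radius \<delta>.\<close>

definition approximation where
  "approximation s b \<epsilon> Y h \<delta> \<longleftrightarrow> (graph_fun \<eta> (axis j 1) Y \<and> (\<forall>x. \<bar>Y x\<bar> < \<epsilon>) \<and> smooth h \<and>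
    (\<forall>x. x \<notin> B \<longrightarrow> h x = 0) \<and> \<delta> > 0 \<and>
    (\<forall>\<alpha> x. mdeg \<alpha> \<le> l \<longrightarrow> norm (mpderiv \<alpha> h x) < \<epsilon>) \<and>
    (\<forall>\<alpha> x. \<bar>x $ j - Y x\<bar> < \<delta> \<longrightarrow> mdeg \<alpha> < s \<or> mdeg \<alpha> = s \<and> b \<le> \<alpha> j \<longrightarrow>
       norm (mpderiv \<alpha> h x - \<tau> \<alpha> x) < \<epsilon>))"

definition approximable :: "nat \<Rightarrow> nat \<Rightarrow> real \<Rightarrow> bool" where
  "approximable s b \<epsilon> \<longleftrightarrow> (\<exists>Y h \<delta>. approximation s b \<epsilon> Y h \<delta>)"

text \<open>The zero function works: a multi-index of degree \<open>Suc l\<close> cannot have an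
  entry \<open>Suc (Suc l)\<close>, so only orders up to \<open>l\<close> count, where the target is
  zero.\<close>

lemma approximable_base:
  assumes "\<epsilon> > 0"
  shows "approximable (Suc l) (Suc (Suc l)) \<epsilon>"
  unfolding approximable_def approximation_def
proof (intro exI[of _ "\<lambda>x. 0"] exI[of _ "1::real"] conjI allI impI)
  show "graph_fun \<eta> (axis j 1) (\<lambda>x. 0)" by (simp add: graph_fun_def smooth_const)
  show "smooth (\<lambda>x::real^'m. 0::real^'n)" by (rule smooth_const)
  show "norm (mpderiv \<alpha> (\<lambda>x. 0::real^'n) x) < \<epsilon>" for \<alpha> and x :: "real^'m"
    using assms by (simp add: mpderiv_mlist iter_pd_zero)
  fix \<alpha> and x :: "real^'m"
  assume "mdeg \<alpha> < Suc l \<or> mdeg \<alpha> = Suc l \<and> Suc (Suc l) \<le> \<alpha> j"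
  then have "mdeg \<alpha> \<le> l" using le_mdeg[of \<alpha> j] by auto
  then show "norm (mpderiv \<alpha> (\<lambda>x. 0) x - \<tau> \<alpha> x) < \<epsilon>"
    using assms \<tau>_low by (simp add: mpderiv_mlist iter_pd_zero)
qed (use assms in auto)

text \<open>Both conditions select the multi-indices of degree at most \<open>s\<close>.\<close>

lemma approximable_next_order: "approximable s 0 \<epsilon> \<Longrightarrow> approximable (Suc s) (Suc (Suc s)) \<epsilon>"
proof -
  have "mdeg \<alpha> < Suc s \<or> mdeg \<alpha> = Suc s \<and> Suc (Suc s) \<le> \<alpha> j \<longleftrightarrow> mdeg \<alpha> < s \<or> mdeg \<alpha> = s \<and> 0 \<le> \<alpha> j" for \<alpha>
    using le_mdeg[of \<alpha> j] by auto
  then show "approximable s 0 \<epsilon> \<Longrightarrow> approximable (Suc s) (Suc (Suc s)) \<epsilon>"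
    unfolding approximable_def approximation_def by simp
qed

text \<open>The correction realises the error in the components with \<alpha> \<open>j = b\<close>.
  On components with larger \<alpha> \<open>j\<close> its prescribed value is zero, and below order
  \<open>s\<close> it is small, so nothing settled is lost.\<close>

lemma approximable_step:
  assumes "l < s" "s \<le> r" "b \<le> s" and \<epsilon>: "\<epsilon> > 0" and prev: "approximable s (Suc b) (\<epsilon> / 2)"
  shows "approximable s b \<epsilon>"
proof -
  obtain Y0 h0 \<delta>0 where 0: "graph_fun \<eta> (axis j 1) Y0" "\<And>x. \<bar>Y0 x\<bar> < \<epsilon>/2" "smooth h0"
    "\<And>x. x \<notin> B \<Longrightarrow> h0 x = 0" "\<delta>0 > 0"
    "\<And>\<alpha> x. mdeg \<alpha> \<le> l \<Longrightarrow> norm (mpderiv \<alpha> h0 x) < \<epsilon>/2"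
    "\<And>\<alpha> x. \<bar>x $ j - Y0 x\<bar> < \<delta>0 \<Longrightarrow> mdeg \<alpha> < s \<or> mdeg \<alpha> = s \<and> Suc b \<le> \<alpha> j \<Longrightarrow>
       norm (mpderiv \<alpha> h0 x - \<tau> \<alpha> x) < \<epsilon>/2"
  proof -
    obtain Y0 h0 \<delta>0 where "approximation s (Suc b) (\<epsilon>/2) Y0 h0 \<delta>0" using prev unfolding approximable_def by blast
    then show thesis unfolding approximation_def by (intro that[of Y0 h0 \<delta>0]) blast+
  qed
  \<comment> \<open>As for superposed oscillations, \<open>\<delta>0/2\<close> keeps the new tube
    inside the old one.\<close>
  define \<epsilon>' where "\<epsilon>' = min (\<epsilon>/2) (\<delta>0/2)"
  have \<epsilon>'_le: "\<epsilon>' \<le> \<epsilon>/2" "\<epsilon>' \<le> \<delta>0/2" by (auto simp: \<epsilon>'_def)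
  \<comment> \<open>The error of the previous approximation. It is smooth, vanishes off
    \<open>B\<close> like \<tau> and \<open>h0\<close>, and may be of any size.\<close>
  let ?\<tau> = "\<lambda>\<alpha> x. \<tau> \<alpha> x - mpderiv \<alpha> h0 x"
  have "\<epsilon>' > 0" using \<epsilon> 0 by (simp add: \<epsilon>'_def)
  have h0_out: "mpderiv \<alpha> h0 x = 0" if "x \<notin> B" for \<alpha> x
    using iter_pd_cong_open[of "- B" x h0 "\<lambda>x. 0" "mlist \<alpha>"] that 0(4) compact_imp_closed[OF B]
    by (simp add: mpderiv_mlist iter_pd_zero open_Compl)
  have "smooth (?\<tau> \<alpha>)" if "mdeg \<alpha> = s" for \<alpha>
    unfolding mpderiv_mlist using that \<open>s \<le> r\<close>
    by (intro smooth_diff \<tau>_smooth smooth_iter_pd[OF 0(3) set_mlist]) simp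
  moreover have "?\<tau> \<alpha> x = 0" if "mdeg \<alpha> = s" "x \<notin> B" for \<alpha> x
    using that \<tau>_support h0_out \<open>s \<le> r\<close> by simp
  ultimately have "\<exists>Y' h \<delta>. graph_fun \<eta> (axis j 1) Y' \<and> (\<forall>x. \<bar>Y' x - Y0 x\<bar> < \<epsilon>') \<and> smooth h \<and>
    (\<forall>x. x \<notin> B \<longrightarrow> h x = 0) \<and> \<delta> > (0::real) \<and>
    (\<forall>\<alpha> x. mdeg \<alpha> < s \<longrightarrow> norm (mpderiv \<alpha> h x) < \<epsilon>') \<and>
    (\<forall>\<alpha> x. mdeg \<alpha> = s \<longrightarrow> b \<le> \<alpha> j \<longrightarrow> \<bar>x $ j - Y' x\<bar> < \<delta> \<longrightarrow>
       norm (mpderiv \<alpha> h x - (if \<alpha> j = b then ?\<tau> \<alpha> x else 0)) < \<epsilon>')"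
    by (intro realize_monomials[OF 0(1) B \<open>b \<le> s\<close> _ _ \<eta> \<open>\<epsilon>' > 0\<close>]) auto
  then obtain Y1 h1 \<delta>1 where 1: "graph_fun \<eta> (axis j 1) Y1" "\<And>x. \<bar>Y1 x - Y0 x\<bar> < \<epsilon>'" "smooth h1"
    "\<And>x. x \<notin> B \<Longrightarrow> h1 x = 0" "\<delta>1 > 0"
    "\<And>\<alpha> x. mdeg \<alpha> < s \<Longrightarrow> norm (mpderiv \<alpha> h1 x) < \<epsilon>'"
    "\<And>\<alpha> x. mdeg \<alpha> = s \<Longrightarrow> b \<le> \<alpha> j \<Longrightarrow> \<bar>x $ j - Y1 x\<bar> < \<delta>1 \<Longrightarrow>
       norm (mpderiv \<alpha> h1 x - (if \<alpha> j = b then ?\<tau> \<alpha> x else 0)) < \<epsilon>'"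
    by (elim exE conjE) (rule that; blast)
  let ?h = "\<lambda>x. h0 x + h1 x"
  have pd: "mpderiv \<alpha> ?h x = mpderiv \<alpha> h0 x + mpderiv \<alpha> h1 x" for \<alpha> x
    using iter_pd_add[OF 0(3) 1(3) set_mlist] by (simp add: mpderiv_mlist)
  show ?thesis
    unfolding approximable_def approximation_def
  proof (intro exI[of _ Y1] exI[of _ ?h] exI[of _ "min \<delta>1 (\<delta>0/2)"] conjI allI impI)
    show "graph_fun \<eta> (axis j 1) Y1" by fact
    show "\<bar>Y1 x\<bar> < \<epsilon>" for x using 0(2)[of x] 1(2)[of x] \<epsilon>'_le by linarith
    show "smooth ?h" by (rule smooth_add[OF 0(3) 1(3)])
    show "?h x = 0" if "x \<notin> B" for x using that 0 1 by simp
    show "min \<delta>1 (\<delta>0/2) > 0" using 0 1 by simp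
    show "norm (mpderiv \<alpha> ?h x) < \<epsilon>" if "mdeg \<alpha> \<le> l" for \<alpha> x
      using 0(6)[OF that, of x] 1(6)[of \<alpha> x] that \<open>l < s\<close> \<epsilon>'_le
        norm_triangle_ineq[of "mpderiv \<alpha> h0 x" "mpderiv \<alpha> h1 x"] unfolding pd by simp
  next
    fix \<alpha> :: "'m \<Rightarrow> nat" and x
    assume near: "\<bar>x $ j - Y1 x\<bar> < min \<delta>1 (\<delta>0/2)" and \<alpha>: "mdeg \<alpha> < s \<or> mdeg \<alpha> = s \<and> b \<le> \<alpha> j"
    have near0: "\<bar>x $ j - Y0 x\<bar> < \<delta>0" using near 1(2)[of x] \<epsilon>'_le by linarith
    have near1: "\<bar>x $ j - Y1 x\<bar> < \<delta>1" using near by simp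
    consider (lower) "mdeg \<alpha> < s" | (settled) "mdeg \<alpha> = s" "Suc b \<le> \<alpha> j" | (new) "mdeg \<alpha> = s" "\<alpha> j = b" using \<alpha> by linarith
    then show "norm (mpderiv \<alpha> ?h x - \<tau> \<alpha> x) < \<epsilon>"
    proof cases
      case lower
      then have "norm (mpderiv \<alpha> h0 x - \<tau> \<alpha> x) < \<epsilon>/2" "norm (mpderiv \<alpha> h1 x) < \<epsilon>/2"
        using 0(7)[OF near0, of \<alpha>] 1(6)[of \<alpha> x] \<epsilon>'_le by auto
      then show ?thesis
        using norm_triangle_ineq[of "mpderiv \<alpha> h0 x - \<tau> \<alpha> x" "mpderiv \<alpha> h1 x"]
        unfolding pd by (simp add: algebra_simps)
    next
      case settled
      then have "norm (mpderiv \<alpha> h0 x - \<tau> \<alpha> x) < \<epsilon>/2" "norm (mpderiv \<alpha> h1 x) < \<epsilon>/2"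
        using 0(7)[OF near0, of \<alpha>] 1(7)[OF _ _ near1, of \<alpha>] \<epsilon>'_le by auto
      then show ?thesis
        using norm_triangle_ineq[of "mpderiv \<alpha> h0 x - \<tau> \<alpha> x" "mpderiv \<alpha> h1 x"]
        unfolding pd by (simp add: algebra_simps)
    next
      case new
      then have "norm (mpderiv \<alpha> h1 x - ?\<tau> \<alpha> x) < \<epsilon>/2"
        using 1(7)[OF _ _ near1, of \<alpha>] \<epsilon>'_le by auto
      then show ?thesis using \<epsilon> unfolding pd by (simp add: algebra_simps)
    qed
  qed
qed

lemma approximable_all:
  assumes "l < s" "s \<le> r" "\<epsilon> > 0"
  shows "approximable s 0 \<epsilon>"
proof -
  \<comment> \<open>Descends from the empty condition \<open>b = Suc s\<close> to
    \<open>b = 0\<close>. Every step halves the tolerance, so the induction carries all \<epsilon>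
    at once.\<close>
  have down: "\<forall>\<epsilon>>0. approximable s 0 \<epsilon>"
    if "l < s" "s \<le> r" "\<forall>\<epsilon>>0. approximable s (Suc s) \<epsilon>" for s
  proof -
    have "0 \<le> Suc s" by simp
    then show ?thesis
    proof (induction rule: inc_induct)
      case (step n)
      then show ?case using approximable_step[OF that(1,2), of n] by simp
    qed (use that in simp)
  qed
  have "Suc l \<le> s" using assms by simp
  then have "s \<le> r \<longrightarrow> (\<forall>\<epsilon>>0. approximable s 0 \<epsilon>)"
  proof (induction rule: dec_induct)
    case base
    then show ?case using down[of "Suc l"] approximable_base by simp
  next
    case (step n)
    then show ?case using down[of "Suc n"] approximable_next_order by simp
  qed
  then show ?thesis using assms by simp
qed

end

section \<open>The shear isotopy and the theorem\<close>

lemma smooth_lipschitz: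
  fixes \<theta> :: "real \<Rightarrow> real"
  assumes "smooth \<theta>" "\<And>u. \<bar>dderiv 1 \<theta> u\<bar> \<le> C"
  shows "\<bar>\<theta> u - \<theta> v\<bar> \<le> C * \<bar>u - v\<bar>"
  using field_differentiable_bound[of UNIV \<theta> "dderiv 1 \<theta>" C u v] smooth_real_DERIV[OF assms(1)] assms(2)
  by simp

text \<open>An implicit function theorem for a solution that is already given on the whole space.
  Differentiating the equation in \<open>u\<close> yields a quantity at least \<open>1/2\<close>,
  and this bound gives continuity, then a first derivative, then all of them.\<close>

lemma smooth_implicit:
  fixes \<gamma> p Y :: "'a::euclidean_space \<Rightarrow> real" and \<theta> :: "real \<Rightarrow> real"
  assumes p: "smooth p" and Y: "smooth Y" and \<theta>: "smooth \<theta>"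
    and C: "\<And>u. \<bar>dderiv 1 \<theta> u\<bar> \<le> C" and CY: "\<And>x. C * \<bar>Y x\<bar> \<le> 1/2"
    and eq: "\<And>x. \<gamma> x + \<theta> (\<gamma> x) * Y x = p x"
  shows "smooth \<gamma>"
proof -
  have lip: "\<bar>\<theta> u - \<theta> v\<bar> \<le> C * \<bar>u - v\<bar>" for u v
    by (rule smooth_lipschitz[OF \<theta> C])
  define D where "D x = 1 + dderiv 1 \<theta> (\<gamma> x) * Y x" for x
  have half: "1 + z * Y x \<ge> 1/2" if "\<bar>z\<bar> \<le> C" for z x
  proof -
    have "\<bar>z * Y x\<bar> \<le> C * \<bar>Y x\<bar>" using that by (simp add: abs_mult mult_right_mono)
    then show ?thesis using CY[of x] by linarith
  qed
  have D_half: "D x \<ge> 1/2" for x unfolding D_def by (rule half[OF C])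
  \<comment> \<open>\<open>z\<close> is the Caratheodory difference quotient of \<theta> at
    \<open>\<gamma> a\<close>. It makes the equation linear in
    \<open>\<gamma> x - \<gamma> a\<close>, with a coefficient bounded away from zero before any
    regularity of \<gamma> is known.\<close>
  have diff: "\<exists>z. isCont z (\<gamma> a) \<and> z (\<gamma> a) = dderiv 1 \<theta> (\<gamma> a) \<and> (\<forall>v. \<bar>z v\<bar> \<le> C) \<and>
      (\<forall>x. (\<gamma> x - \<gamma> a) * (1 + z (\<gamma> x) * Y x) = p x - p a - \<theta> (\<gamma> a) * (Y x - Y a))" for a
  proof -
    obtain z where z: "\<And>v. \<theta> v - \<theta> (\<gamma> a) = z v * (v - \<gamma> a)" "isCont z (\<gamma> a)" "z (\<gamma> a) = dderiv 1 \<theta> (\<gamma> a)"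
      using smooth_real_DERIV[OF \<theta>, of "\<gamma> a"] unfolding CARAT_DERIV by blast
    have "\<bar>z v\<bar> \<le> C" for v
    proof (cases "v = \<gamma> a")
      case False
      have "\<bar>z v\<bar> * \<bar>v - \<gamma> a\<bar> \<le> C * \<bar>v - \<gamma> a\<bar>"
        using lip[of v "\<gamma> a"] by (simp add: z(1) abs_mult)
      then show ?thesis using False by simp
    qed (use C z in simp)
    moreover have "(\<gamma> x - \<gamma> a) * (1 + z (\<gamma> x) * Y x) = p x - p a - \<theta> (\<gamma> a) * (Y x - Y a)" for x
    proof -
      have "(\<gamma> x - \<gamma> a) * (1 + z (\<gamma> x) * Y x) = (\<gamma> x - \<gamma> a) + (\<theta> (\<gamma> x) - \<theta> (\<gamma> a)) * Y x"
        by (simp add: z(1) algebra_simps)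
      then show ?thesis by (simp add: eq[symmetric] algebra_simps)
    qed
    ultimately show ?thesis using z by blast
  qed
  have tend: "((\<lambda>x. p x - p a - \<theta> (\<gamma> a) * (Y x - Y a)) \<longlongrightarrow> 0) (at a)" for a
  proof -
    have "isCont p a" "isCont Y a"
      using smooth_continuous[OF p] smooth_continuous[OF Y] by (simp_all add: continuous_on_eq_continuous_at)
    then have "((\<lambda>x. p x - p a - \<theta> (\<gamma> a) * (Y x - Y a)) \<longlongrightarrow> p a - p a - \<theta> (\<gamma> a) * (Y a - Y a)) (at a)"
      unfolding isCont_def by (intro tendsto_intros)
    then show ?thesis by simp
  qed
  have cont: "isCont \<gamma> a" for a
  proof -
    obtain z where z: "\<And>v. \<bar>z v\<bar> \<le> C"
      "\<And>x. (\<gamma> x - \<gamma> a) * (1 + z (\<gamma> x) * Y x) = p x - p a - \<theta> (\<gamma> a) * (Y x - Y a)"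
      using diff by blast
    have bound: "\<bar>\<gamma> x - \<gamma> a\<bar> \<le> 2 * \<bar>p x - p a - \<theta> (\<gamma> a) * (Y x - Y a)\<bar>" for x
    proof -
      have "\<bar>\<gamma> x - \<gamma> a\<bar> * (1/2) \<le> \<bar>\<gamma> x - \<gamma> a\<bar> * \<bar>1 + z (\<gamma> x) * Y x\<bar>"
        using half[OF z(1), of "\<gamma> x" x] by (intro mult_left_mono) auto
      then show ?thesis unfolding z(2)[symmetric] abs_mult by simp
    qed
    have lim: "((\<lambda>x. 2 * \<bar>p x - p a - \<theta> (\<gamma> a) * (Y x - Y a)\<bar>) \<longlongrightarrow> 0) (at a)"
      using tendsto_mult[OF tendsto_const tendsto_rabs[OF tend]] by simp
    have "((\<lambda>x. \<gamma> x - \<gamma> a) \<longlongrightarrow> 0) (at a)"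
      by (rule Lim_null_comparison[OF _ lim]) (simp only: real_norm_def bound always_eventually simp_thms)
    then show ?thesis unfolding isCont_def by (simp add: LIM_zero_iff)
  qed
  have cont_\<gamma>: "continuous_on UNIV \<gamma>" using cont by (simp add: continuous_at_imp_continuous_on)
  have der: "has_dderiv e \<gamma> ((dderiv e p a - \<theta> (\<gamma> a) * dderiv e Y a) * inverse (D a)) a" if e: "e \<in> Basis" for e a
  proof -
    obtain z where z: "isCont z (\<gamma> a)" "z (\<gamma> a) = dderiv 1 \<theta> (\<gamma> a)" "\<And>v. \<bar>z v\<bar> \<le> C"
      "\<And>x. (\<gamma> x - \<gamma> a) * (1 + z (\<gamma> x) * Y x) = p x - p a - \<theta> (\<gamma> a) * (Y x - Y a)"
      using diff by blast
    let ?X = "\<lambda>t::real. a + t *\<^sub>R e"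
    let ?R = "\<lambda>t. p (?X t) - \<theta> (\<gamma> a) * Y (?X t)"
    have X: "isCont ?X 0" by (intro continuous_intros)
    have "isCont Y (?X 0)" using smooth_continuous[OF Y] by (simp add: continuous_on_eq_continuous_at)
    then have cY: "isCont (\<lambda>t. Y (?X t)) 0" using isCont_o2[OF X] by blast
    have c\<gamma>: "isCont (\<lambda>t. \<gamma> (?X t)) 0" by (rule isCont_o2[OF X cont])
    have "isCont (\<lambda>t. z (\<gamma> (?X t))) 0" using isCont_o2[OF c\<gamma>, of z] z(1) by simp
    then have "isCont (\<lambda>t. 1 + z (\<gamma> (?X t)) * Y (?X t)) 0" using cY by (intro continuous_intros)
    then have den: "((\<lambda>t. 1 + z (\<gamma> (?X t)) * Y (?X t)) \<longlongrightarrow> D a) (at 0)"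
      unfolding isCont_def by (simp add: D_def z(2))
    have "(?R has_real_derivative (dderiv e p a - \<theta> (\<gamma> a) * dderiv e Y a)) (at 0)"
      using smooth_has_dderiv[OF p e, of a] smooth_has_dderiv[OF Y e, of a]
      unfolding has_dderiv_def has_real_derivative_iff_has_vector_derivative[symmetric]
      by (auto intro!: derivative_eq_intros)
    then have "((\<lambda>t. (?R t - ?R 0) / (t - 0)) \<longlongrightarrow> dderiv e p a - \<theta> (\<gamma> a) * dderiv e Y a) (at 0)"
      unfolding has_field_derivative_iff .
    moreover have "D a \<noteq> 0" using D_half[of a] by linarith
    ultimately have "((\<lambda>t. (?R t - ?R 0) / (t - 0) / (1 + z (\<gamma> (?X t)) * Y (?X t)))
        \<longlongrightarrow> (dderiv e p a - \<theta> (\<gamma> a) * dderiv e Y a) / D a) (at 0)"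
      by (intro tendsto_divide den)
    moreover have "(?R t - ?R 0) / (t - 0) / (1 + z (\<gamma> (?X t)) * Y (?X t)) = (\<gamma> (?X t) - \<gamma> (?X 0)) / (t - 0)" for t
    proof -
      have "1 + z (\<gamma> (?X t)) * Y (?X t) \<noteq> 0" using half[OF z(3), of "\<gamma> (?X t)" "?X t"] by linarith
      moreover have "(\<gamma> (?X t) - \<gamma> a) * (1 + z (\<gamma> (?X t)) * Y (?X t)) = ?R t - ?R 0"
        unfolding z(4) by (simp add: algebra_simps)
      ultimately have "\<gamma> (?X t) - \<gamma> a = (?R t - ?R 0) / (1 + z (\<gamma> (?X t)) * Y (?X t))"
        by (simp add: eq_divide_eq)
      then show ?thesis by simp
    qed
    ultimately have "((\<lambda>t. \<gamma> (?X t)) has_real_derivative (dderiv e p a - \<theta> (\<gamma> a) * dderiv e Y a) / D a) (at 0)"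
      unfolding has_field_derivative_iff by simp
    then show ?thesis
      unfolding has_dderiv_def has_real_derivative_iff_has_vector_derivative[symmetric] by (simp add: divide_inverse)
  qed
  \<comment> \<open>Derivatives of \<gamma> contain \<open>inverse D\<close>, and those of
    \<open>D\<close> contain further derivatives of \<theta> at \<gamma>. Admitting all smooth
    functions of \<gamma> closes the system.\<close>
  let ?G = "{f. smooth f} \<union> {(\<lambda>x. \<phi> (\<gamma> x)) | \<phi>. smooth \<phi>} \<union> {\<lambda>x. inverse (D x)}"
  have in_G: "(\<lambda>x. \<phi> (\<gamma> x)) \<in> alg ?G" if "smooth \<phi>" for \<phi>
    using that by (intro alg.gen) auto
  have invD: "(\<lambda>x. inverse (D x)) \<in> alg ?G" by (intro alg.gen) auto
  have smooth_G: "f \<in> alg ?G" if "smooth f" for f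
    using that by (intro alg.gen) auto
  define \<gamma>' where "\<gamma>' e x = (dderiv e p x + (-1) * (\<theta> (\<gamma> x) * dderiv e Y x)) * inverse (D x)" for e x
  have \<gamma>': "\<gamma>' e \<in> alg ?G" if "e \<in> Basis" for e
    unfolding \<gamma>'_def
    by (rule alg.mult[OF alg.add[OF smooth_G alg.mult[OF smooth_G alg.mult[OF in_G smooth_G]]] invD])
      (use that p Y \<theta> in \<open>simp_all add: smooth_dderiv smooth_const\<close>)
  have der': "has_dderiv e \<gamma> (\<gamma>' e x) x" if "e \<in> Basis" for e x
    using der[OF that] by (simp add: \<gamma>'_def)
  have s1: "smooth (dderiv 1 \<theta>)" by (rule smooth_dderiv[OF \<theta>]) simp
  have cD: "continuous_on UNIV D"
    unfolding D_def[abs_def]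
    by (intro continuous_intros smooth_continuous[OF Y] continuous_on_compose2[OF smooth_continuous[OF s1] cont_\<gamma>]) auto
  have nD: "D x \<noteq> 0" for x using D_half[of x] by linarith
  show ?thesis
  proof (rule smooth_alg[where G = ?G], goal_cases)
    case (1 g)
    then consider "smooth g" | \<phi> where "g = (\<lambda>x. \<phi> (\<gamma> x))" "smooth \<phi>" | "g = (\<lambda>x. inverse (D x))" by blast
    then show ?case
    proof cases
      case 2
      then show ?thesis using continuous_on_compose2[OF smooth_continuous[OF 2(2)] cont_\<gamma>] by simp
    qed (use nD in \<open>auto intro!: continuous_on_inverse cD dest: smooth_continuous\<close>)
  next
    case (2 g e)
    then consider (smooth) "smooth g" | (comp) \<phi> where "g = (\<lambda>x. \<phi> (\<gamma> x))" "smooth \<phi>"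
      | (inv) "g = (\<lambda>x. inverse (D x))" by blast
    then show ?case
    proof cases
      case smooth
      then show ?thesis using 2 by (intro smooth_generator) auto
    next
      case (comp \<phi>)
      have "smooth (dderiv 1 \<phi>)" by (rule smooth_dderiv[OF comp(2)]) simp
      then have "(\<lambda>x. \<gamma>' e x * dderiv 1 \<phi> (\<gamma> x)) \<in> alg ?G"
        by (intro alg.mult \<gamma>' in_G 2(2))
      then show ?thesis unfolding comp(1)
        by (rule bexI[rotated])
          (intro allI has_dderiv_chain[OF der'[OF 2(2)]] smooth_real_DERIV[OF comp(2)])
    next
      case inv
      have s2: "smooth (dderiv 1 (dderiv 1 \<theta>))" by (rule smooth_dderiv[OF s1]) simp
      let ?D' = "\<lambda>x. dderiv 1 \<theta> (\<gamma> x) * dderiv e Y x + (\<gamma>' e x * dderiv 1 (dderiv 1 \<theta>) (\<gamma> x)) * Y x"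
      have "has_dderiv e D (0 + ?D' x) x" for x
        unfolding D_def[abs_def]
        by (intro has_dderiv_add has_dderiv_const has_dderiv_mult smooth_has_dderiv Y 2(2)
            has_dderiv_chain[OF der'[OF 2(2)]] smooth_real_DERIV[OF s1])
      then have "has_dderiv e g ((0 + ?D' x) * - (inverse (D x) ^ Suc (Suc 0))) x" for x
        unfolding inv using nD by (intro has_dderiv_chain DERIV_inverse)
      then have "\<forall>x. has_dderiv e g ((-1) * ?D' x * (inverse (D x) * inverse (D x))) x"
        by (simp add: algebra_simps)
      moreover have "?D' \<in> alg ?G"
        by (rule alg.add[OF alg.mult[OF in_G smooth_G] alg.mult[OF alg.mult[OF \<gamma>' in_G] smooth_G]])
          (use 2 Y s1 s2 in \<open>simp_all add: smooth_dderiv\<close>)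
      then have "(\<lambda>x. (-1) * ?D' x * (inverse (D x) * inverse (D x))) \<in> alg ?G"
        by (rule alg.mult[OF alg.mult[OF smooth_G[OF smooth_const]] alg.mult[OF invD invD]])
      ultimately show ?thesis by (rule bexI)
    qed
  next
    case 3
    show ?case using in_G[of "\<lambda>u. u"] smooth_linear[OF bounded_linear_ident] by simp
  qed
qed

section \<open>Shears along one coordinate axis\<close>

lemma smooth_compose_snd:
  assumes "smooth f"
  shows "smooth (\<lambda>p::'c::euclidean_space \<times> 'a::euclidean_space. f (snd p))"
proof (rule smooth_coinduct[where \<F> = "{\<lambda>p. f (snd p) |f. smooth f}"], goal_cases)
  case (2 g)
  then obtain f where "g = (\<lambda>p. f (snd p))" "smooth f" by blast
  then show ?case
    by (auto intro!: continuous_on_compose2[OF smooth_continuous[of f]] continuous_intros)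
next
  case (3 g v)
  then obtain f where g: "g = (\<lambda>p. f (snd p))" and f: "smooth f" by blast
  from 3(2) consider b where "v = (b, 0)" | b where "v = (0, b)" "b \<in> Basis"
    by (auto simp: Basis_prod_def)
  then show ?case
  proof cases
    case 1
    then have "has_dderiv v g 0 x" for x
      unfolding g has_dderiv_def by simp
    then show ?thesis
      by (intro bexI[of _ "\<lambda>p. 0"]) (auto intro!: exI[of _ "\<lambda>x. 0"] smooth_const)
  next
    case 2
    then have "has_dderiv v g (dderiv b f (snd x)) x" for x
      using smooth_has_dderiv[OF f, of b "snd x"] unfolding g has_dderiv_def by simp
    then show ?thesis
      using smooth_dderiv[OF f 2(2)] by (intro bexI[of _ "\<lambda>p. dderiv b f (snd p)"]) auto
  qed
qed (use assms in auto)

text \<open>On each line in direction \<open>j\<close> the map is the identity plus a function of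
  Lipschitz constant at most \<open>1/2\<close>. Hence it is bijective on the line, and its inverse
  solves the equation of \<open>smooth_implicit\<close>.\<close>

lemma shear_isotopy:
  fixes Y :: "real^'m::finite \<Rightarrow> real" and \<theta> :: "real \<Rightarrow> real"
  assumes Y: "smooth Y" and flat: "\<And>x t. Y (x + t *\<^sub>R axis j 1) = Y x"
    and \<theta>: "smooth \<theta>" "\<And>u. \<bar>u\<bar> \<ge> \<rho> \<Longrightarrow> \<theta> u = 0" "\<And>u. 0 \<le> \<theta> u" "\<And>u. \<theta> u \<le> 1"
    and C: "\<And>u. \<bar>dderiv 1 \<theta> u\<bar> \<le> C"
    and small: "\<rho> < 1" "\<And>x. \<bar>Y x\<bar> \<le> 1 - \<rho>" "\<And>x. C * \<bar>Y x\<bar> \<le> 1/2"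
  shows "isotopy (\<lambda>t x. x + (t * \<theta> (x $ j) * Y x) *\<^sub>R axis j 1)"
proof -
  let ?e = "axis j 1 :: real^'m"
  let ?F = "\<lambda>t x. x + (t * \<theta> (x $ j) * Y x) *\<^sub>R ?e"
  have comp: "(x + s *\<^sub>R ?e) $ i = (if i = j then x $ j + s else x $ i)" for x s i
    by (simp add: axis_def)
  have bl: "bounded_linear (\<lambda>x::real^'m. x $ j)" by (rule bounded_linear_vec_nth)
  have "smooth (\<lambda>p::real \<times> (real^'m). snd p + (fst p * \<theta> (snd p $ j) * Y (snd p)) *\<^sub>R ?e)"
    by (rule smooth_add[OF smooth_linear[OF bounded_linear_snd] smooth_scaleR[OF smooth_mult[OF
          smooth_mult[OF smooth_linear[OF bounded_linear_fst] smooth_compose_snd[OF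
          smooth_compose[OF \<theta>(1) smooth_linear[OF bl]]]] smooth_compose_snd[OF Y]] smooth_const]])
  then have sm: "smooth (\<lambda>(t, x). ?F t x)" by (simp add: case_prod_unfold)
  have C0: "C \<ge> 0" using C[of 0] by linarith
  have main: "bij_betw (?F t) cube cube \<and> (\<exists>S g. cube \<subseteq> S \<and> smooth_on S g \<and> (\<forall>x\<in>cube. g (?F t x) = x))"
    if t: "t \<in> {0..1}" for t
  proof -
    define Z where "Z x = t * Y x" for x
    have Z_le: "\<bar>Z x\<bar> \<le> \<bar>Y x\<bar>" for x
      using t mult_right_mono[of t 1 "\<bar>Y x\<bar>"] by (simp add: Z_def abs_mult)
    have CZ: "C * \<bar>Z x\<bar> \<le> 1/2" for x
      using small(3)[of x] mult_left_mono[OF Z_le C0, of x] by linarith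
    have sZ: "smooth Z" unfolding Z_def[abs_def] by (rule smooth_mult[OF smooth_const Y])
    have Z_flat: "Z (x + s *\<^sub>R ?e) = Z x" for x s by (simp add: Z_def flat)
    have F_eq: "?F t x = x + (\<theta> (x $ j) * Z x) *\<^sub>R ?e" for x by (simp add: Z_def mult_ac)
    have lip: "\<bar>\<theta> u - \<theta> v\<bar> \<le> C * \<bar>u - v\<bar>" for u v
      by (rule smooth_lipschitz[OF \<theta>(1) C])
    have uniq: "u = v" if "u + \<theta> u * Z x = v + \<theta> v * Z x" for u v x
    proof -
      have "\<bar>u - v\<bar> = \<bar>\<theta> u - \<theta> v\<bar> * \<bar>Z x\<bar>"
        using that by (simp add: abs_mult[symmetric] algebra_simps abs_minus_commute)
      also have "\<dots> \<le> C * \<bar>u - v\<bar> * \<bar>Z x\<bar>" by (rule mult_right_mono[OF lip]) simp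
      also have "\<dots> = (C * \<bar>Z x\<bar>) * \<bar>u - v\<bar>" by simp
      also have "\<dots> \<le> 1/2 * \<bar>u - v\<bar>" by (rule mult_right_mono[OF CZ]) simp
      finally show ?thesis by simp
    qed
    have bd: "\<bar>\<theta> u * Z x\<bar> \<le> \<bar>Z x\<bar>" for u x
      using mult_right_mono[OF \<theta>(4), of "\<bar>Z x\<bar>" u] \<theta>(3)[of u] by (simp add: abs_mult)
    \<comment> \<open>The perturbation is at most \<open>\<bar>Z x\<bar>\<close>, so the
      intermediate value theorem applies on the interval of that radius around
      \<open>x $ j\<close>.\<close>
    have "\<exists>u. u + \<theta> u * Z x = x $ j" for x
    proof -
      let ?f = "\<lambda>u. u + \<theta> u * Z x" and ?c = "\<bar>Z x\<bar>"
      have "continuous_on UNIV ?f" using smooth_continuous[OF \<theta>(1)] by (intro continuous_intros)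
      then have "continuous_on {x $ j - ?c..x $ j + ?c} ?f" using continuous_on_subset by blast
      moreover have "?f (x $ j - ?c) \<le> x $ j" "x $ j \<le> ?f (x $ j + ?c)"
        using bd[of "x $ j - ?c" x] bd[of "x $ j + ?c" x] by linarith+
      ultimately show ?thesis using IVT'[of ?f "x $ j - ?c" "x $ j" "x $ j + ?c"] by auto
    qed
    then obtain \<gamma> where \<gamma>: "\<And>x. \<gamma> x + \<theta> (\<gamma> x) * Z x = x $ j" by metis
    have s\<gamma>: "smooth \<gamma>" by (rule smooth_implicit[OF smooth_linear[OF bl] sZ \<theta>(1) C CZ \<gamma>])
    define g where "g x = x + (\<gamma> x - x $ j) *\<^sub>R ?e" for x
    have sg: "smooth g"
      unfolding g_def[abs_def]
      by (rule smooth_add[OF smooth_linear[OF bounded_linear_ident]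
            smooth_scaleR[OF smooth_diff[OF s\<gamma> smooth_linear[OF bl]] smooth_const]])
    have gF: "g (?F t x) = x" for x
    proof -
      have "\<gamma> (?F t x) = x $ j"
      proof (rule uniq)
        have Z: "Z (?F t x) = Z x" unfolding F_eq by (rule Z_flat)
        have j: "?F t x $ j = x $ j + \<theta> (x $ j) * Z x" unfolding F_eq comp by simp
        show "\<gamma> (?F t x) + \<theta> (\<gamma> (?F t x)) * Z x = x $ j + \<theta> (x $ j) * Z x"
          using \<gamma>[of "?F t x"] by (simp only: Z j)
      qed
      then show ?thesis unfolding g_def F_eq by (simp add: comp vec_eq_iff)
    qed
    have Fg: "?F t (g x) = x" for x
    proof -
      have "?F t (g x) = x + ((\<gamma> x - x $ j) *\<^sub>R ?e + (\<theta> (\<gamma> x) * Z x) *\<^sub>R ?e)"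
        unfolding F_eq g_def by (simp add: comp Z_flat)
      also have "\<dots> = x + (\<gamma> x + \<theta> (\<gamma> x) * Z x - x $ j) *\<^sub>R ?e"
        by (simp only: scaleR_left_distrib[symmetric]) (simp add: algebra_simps)
      finally show ?thesis by (simp add: \<gamma>)
    qed
    have Fc: "?F t x \<in> cube" if "x \<in> cube" for x
    proof -
      have "\<bar>x $ j + \<theta> (x $ j) * Z x\<bar> \<le> 1"
      \<comment> \<open>Either \<theta> vanishes and the point is fixed, or it has room
        \<open>1 - \<rho>\<close> to the faces, which \<open>Y\<close> does not exceed.\<close>
      proof (cases "\<bar>x $ j\<bar> \<ge> \<rho>")
        case True
        then show ?thesis using that \<theta>(2) by (simp add: cube_def)
      next
        case False
        then show ?thesis using bd[of "x $ j" x] Z_le[of x] small(2)[of x] by linarith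
      qed
      then show ?thesis using that unfolding F_eq cube_def mem_Collect_eq comp by simp
    qed
    have gc: "g x \<in> cube" if "x \<in> cube" for x
    proof -
      have "\<bar>\<gamma> x\<bar> \<le> 1"
      proof (cases "\<bar>\<gamma> x\<bar> \<ge> \<rho>")
        case True
        then show ?thesis using that \<theta>(2) \<gamma>[of x] by (simp add: cube_def)
      qed (use small in linarith)
      then show ?thesis using that unfolding g_def cube_def mem_Collect_eq comp by simp
    qed
    have "bij_betw (?F t) cube cube"
      by (rule bij_betwI[where g = g]) (use Fc gc gF Fg in auto)
    then show ?thesis using sg gF by blast
  qed
  show ?thesis
    unfolding isotopy_def
    by (intro conjI exI[of _ UNIV] ballI sm subset_UNIV main[THEN conjunct1] main[THEN conjunct2]) auto
qed

section \<open>Jet norms and the geometry of the cube\<close>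

lemma jet_norm_less:
  fixes s :: "('m::finite \<Rightarrow> nat) \<Rightarrow> real^'n::finite"
  assumes "\<And>\<alpha>. mdeg \<alpha> \<le> k \<Longrightarrow> norm (s \<alpha>) < \<epsilon>"
  shows "jet_norm k s < \<epsilon>"
proof -
  have "(\<lambda>_. 0) \<in> {\<alpha>::'m \<Rightarrow> nat. mdeg \<alpha> \<le> k}" by (simp add: mdeg_def)
  then have "{\<alpha>::'m \<Rightarrow> nat. mdeg \<alpha> \<le> k} \<noteq> {}" by blast
  then show ?thesis unfolding jet_norm_def
    using assms finite_mdeg_le[of k] by (subst Max_less_iff) auto
qed

lemma mfact_ge_1: "mfact \<alpha> \<ge> 1"
  unfolding mfact_def by (intro prod_ge_1) (simp add: fact_ge_1)

lemma mem_symmetric_box: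
  fixes x :: "real^'m::finite"
  shows "x \<in> cbox (\<chi> i. - c) (\<chi> i. c) \<longleftrightarrow> (\<forall>i. \<bar>x $ i\<bar> \<le> c)"
    and "x \<in> box (\<chi> i. - c) (\<chi> i. c) \<longleftrightarrow> (\<forall>i. \<bar>x $ i\<bar> < c)"
proof -
  have "- c \<le> a \<and> a \<le> c \<longleftrightarrow> \<bar>a\<bar> \<le> c" "- c < a \<and> a < c \<longleftrightarrow> \<bar>a\<bar> < c" for a :: real by linarith+
  then show "x \<in> cbox (\<chi> i. - c) (\<chi> i. c) \<longleftrightarrow> (\<forall>i. \<bar>x $ i\<bar> \<le> c)"
    "x \<in> box (\<chi> i. - c) (\<chi> i. c) \<longleftrightarrow> (\<forall>i. \<bar>x $ i\<bar> < c)"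
    by (simp_all add: mem_box_cart)
qed

lemma cube_eq_cbox: "cube = cbox (\<chi> i. - 1) (\<chi> i. 1)"
  by (simp add: cube_def set_eq_iff mem_symmetric_box)

lemma frontier_cube: "frontier cube = {x. (\<forall>i. \<bar>x $ i\<bar> \<le> 1) \<and> (\<exists>i. \<bar>x $ i\<bar> = 1)}"
  unfolding cube_eq_cbox frontier_cbox
  by (auto simp: mem_symmetric_box less_le)

lemma compact_in_cube_interior:
  fixes A :: "(real^'m::finite) set"
  assumes "compact A" "\<And>x i. x \<in> A \<Longrightarrow> \<bar>x $ i\<bar> < 1"
  obtains \<rho> where "0 \<le> \<rho>" "\<rho> < 1" "\<And>x i. x \<in> A \<Longrightarrow> \<bar>x $ i\<bar> \<le> \<rho>"
proof -
  have "\<exists>r<1. \<forall>x\<in>A. \<bar>x $ i\<bar> \<le> r" for i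
  proof (cases "A = {}")
    case False
    have "continuous_on A (\<lambda>x. \<bar>x $ i\<bar>)" by (intro continuous_intros)
    then obtain x where "x \<in> A" "\<forall>y\<in>A. \<bar>y $ i\<bar> \<le> \<bar>x $ i\<bar>"
      using continuous_attains_sup[OF assms(1) False] by blast
    then show ?thesis using assms(2) by blast
  qed (auto intro: exI[of _ 0])
  then obtain r where r: "\<And>i. r i < 1" "\<And>i x. x \<in> A \<Longrightarrow> \<bar>x $ i\<bar> \<le> r i" by metis
  let ?\<rho> = "Max (insert 0 (range r))"
  have "?\<rho> \<ge> 0" by (rule Max_ge) auto
  moreover have "?\<rho> < 1" by (subst Max_less_iff) (auto simp: r)
  moreover have "r i \<le> ?\<rho>" for i by (rule Max_ge) auto
  ultimately show thesis by (intro that[of ?\<rho>]) (auto intro!: order_trans[OF r(2)])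
qed

theorem mainTheorem7:
  fixes \<sigma> :: "real^'m::finite \<Rightarrow> ('m \<Rightarrow> nat) \<Rightarrow> real^'n::finite"
    and K :: "'m set" and k l r :: nat and \<epsilon> :: real
  assumes "card K = k" and "k < CARD('m)" and "l < r"
    and "\<exists>S. cube \<subseteq> S \<and> (\<forall>\<alpha>. mdeg \<alpha> \<le> r \<longrightarrow> smooth_on S (\<lambda>x. \<sigma> x \<alpha>))"
    and "\<exists>V. open V \<and> frontier cube \<subseteq> V \<and> (\<forall>x\<in>V \<inter> cube. jet_zero r (\<sigma> x))"
    and "\<forall>x\<in>cube. jet_zero l (\<sigma> x)"
    and "\<epsilon> > 0"
  shows "\<exists>F h. isotopy F \<and> (\<exists>S. cube \<subseteq> S \<and> smooth_on S h) \<and>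
     (\<exists>U. open U \<and> F 1 ` subcube K \<subseteq> U \<and>
        (\<forall>x\<in>U \<inter> cube. jet_norm r (\<lambda>\<alpha>. jet r h x \<alpha> - \<sigma> x \<alpha>) < \<epsilon>)) \<and>
     (\<forall>x\<in>cube. jet_norm l (jet r h x) < \<epsilon>) \<and>
     (\<forall>t\<in>{0..1}. \<forall>x\<in>cube. dist (F t x) x < \<epsilon>) \<and>
     (\<exists>V. open V \<and> frontier cube \<subseteq> V \<and>
        (\<forall>x\<in>V \<inter> cube. (\<forall>t\<in>{0..1}. F t x = x) \<and> jet_zero r (jet r h x)))"
proof -
  have "K \<noteq> UNIV" using assms(1,2) by auto
  \<comment> \<open>The subcube lies in the hyperplane \<open>x $ j = 0\<close>, which is the one to
    be wiggled.\<close>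
  then obtain j where j: "j \<notin> K" by blast
  obtain S where S: "cube \<subseteq> S" "\<And>\<alpha>. mdeg \<alpha> \<le> r \<Longrightarrow> smooth_on S (\<lambda>x. \<sigma> x \<alpha>)" using assms(4) by blast
  obtain V where V: "open V" "frontier cube \<subseteq> V" "\<And>x. x \<in> V \<Longrightarrow> x \<in> cube \<Longrightarrow> jet_zero r (\<sigma> x)"
    using assms(5) by blast
  have comp: "compact (cube - V :: (real^'m) set)"
    unfolding cube_eq_cbox by (intro compact_diff compact_cbox V(1))
  have int: "\<bar>x $ i\<bar> < 1" if "x \<in> cube - V" for x :: "real^'m" and i
  proof -
    have "\<bar>x $ i\<bar> \<le> 1" using that by (simp add: cube_def)
    moreover have "\<bar>x $ i\<bar> \<noteq> 1"
    proof
      assume "\<bar>x $ i\<bar> = 1"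
      then have "x \<in> frontier cube" unfolding frontier_cube using that by (auto simp: cube_def)
      then show False using V(2) that by blast
    qed
    ultimately show ?thesis by simp
  qed
  obtain \<rho>0 where \<rho>0: "0 \<le> \<rho>0" "\<rho>0 < 1" "\<And>x i. x \<in> cube - V \<Longrightarrow> \<bar>x $ i\<bar> \<le> \<rho>0"
    using compact_in_cube_interior[OF comp int] by blast
  \<comment> \<open>Two nested boxes: the jet is supported in the one of half-width
    \<open>\<rho>0\<close>, and the isotopy moves nothing outside the one of half-width \<rho>. The
    gap leaves space for the cutoff \<theta>.\<close>
  define \<rho> where "\<rho> = (1 + \<rho>0) / 2"
  have \<rho>: "\<rho>0 < \<rho>" "\<rho> < 1" using \<rho>0 by (auto simp: \<rho>_def)
  define B :: "(real^'m) set" where "B = cbox (\<chi> i. -\<rho>0) (\<chi> i. \<rho>0)"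
  have B_iff: "x \<in> B \<longleftrightarrow> (\<forall>i. \<bar>x $ i\<bar> \<le> \<rho>0)" for x by (simp add: B_def mem_symmetric_box)
  have B: "compact B" unfolding B_def by (rule compact_cbox)
  have oB: "open (- B)" using compact_imp_closed[OF B] by (simp add: open_Compl)
  obtain \<theta> :: "real \<Rightarrow> real" where \<theta>: "smooth \<theta>" "\<And>u. \<bar>u\<bar> \<le> \<rho>0 \<Longrightarrow> \<theta> u = 1" "\<And>u. \<bar>u\<bar> \<ge> \<rho> \<Longrightarrow> \<theta> u = 0"
    "\<And>u. 0 \<le> \<theta> u" "\<And>u. \<theta> u \<le> 1"
    by (rule smooth_bump_exists[OF \<rho>0(1) \<rho>(1)]) (rule that)
  have \<theta>_out: "\<theta> u = 0" if "u \<in> - {-\<rho>..\<rho>}" for u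
    using that by (intro \<theta>(3)) auto
  have "dderiv 1 \<theta> u = 0" if "u \<notin> {-\<rho>..\<rho>}" for u
    using dderiv_cong_open[of "- {-\<rho>..\<rho>}" u \<theta> "\<lambda>_. 0" 1, OF _ _ \<theta>_out] that
    by (simp add: open_Compl dderiv_zero)
  moreover have "continuous_on UNIV (dderiv 1 \<theta>)"
    by (rule smooth_continuous[OF smooth_dderiv[OF \<theta>(1)]]) simp
  ultimately obtain C where C: "\<And>u. \<bar>dderiv 1 \<theta> u\<bar> \<le> C"
    using bounded_of_compact_support[of "dderiv 1 \<theta>" "{-\<rho>..\<rho>}"] by auto
  have C0: "C \<ge> 0" using C[of 0] by linarith
  \<comment> \<open>The coordinate \<open>j\<close> is left out so that \<eta> does not change along
    the shear; in that direction \<theta> in the isotopy does the cutting off.\<close>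
  define \<eta> :: "real^'m \<Rightarrow> real" where "\<eta> x = (\<Prod>i\<in>UNIV - {j}. \<theta> (x $ i))" for x
  have \<eta>: "smooth \<eta>" "\<And>x. x \<in> B \<Longrightarrow> \<eta> x = 1" "\<And>x. \<bar>\<eta> x\<bar> \<le> 1" "\<And>x t. \<eta> (x + t *\<^sub>R axis j 1) = \<eta> x"
  proof -
    show "smooth \<eta>" unfolding \<eta>_def[abs_def]
      by (intro smooth_prod smooth_compose[OF \<theta>(1)] smooth_linear bounded_linear_vec_nth)
    show "\<eta> x = 1" if "x \<in> B" for x using that \<theta>(2) by (simp add: \<eta>_def B_iff)
    show "\<bar>\<eta> x\<bar> \<le> 1" for x
      using prod_le_1[of "UNIV - {j}" "\<lambda>i. \<theta> (x $ i)"] prod_nonneg[of "UNIV - {j}" "\<lambda>i. \<theta> (x $ i)"] \<theta>(4,5)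
      by (simp add: \<eta>_def)
    show "\<eta> (x + t *\<^sub>R axis j 1) = \<eta> x" for x t
      unfolding \<eta>_def by (intro prod.cong) (auto simp: axis_def)
  qed
  \<comment> \<open>The factor turns Taylor coefficients into derivatives. As it is at least
    \<open>1\<close>, dividing by it later only improves the estimates.\<close>
  define \<tau> where "\<tau> \<alpha> x = mfact \<alpha> *\<^sub>R (if x \<in> cube then \<sigma> x \<alpha> else 0)" for \<alpha> x
  have \<sigma>_out: "\<sigma> x \<alpha> = 0" if "x \<in> cube" "x \<notin> B" "mdeg \<alpha> \<le> r" for x \<alpha>
    using that \<rho>0(3)[of x] V(3)[of x] by (auto simp: B_iff jet_zero_def)
  interpret jet_target \<tau> j \<eta> B l r
  proof
    show "compact B" by (rule B)
    show "\<tau> \<alpha> x = 0" if "mdeg \<alpha> \<le> r" "x \<notin> B" for \<alpha> x using \<sigma>_out that by (simp add: \<tau>_def)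
    show "\<tau> \<alpha> x = 0" if "mdeg \<alpha> \<le> l" for \<alpha> x using that assms(6) by (simp add: \<tau>_def jet_zero_def)
    show "smooth \<eta>" by (rule \<eta>)
    show "\<eta> x = 1" if "x \<in> B" for x using that by (rule \<eta>)
    show "\<bar>\<eta> x\<bar> \<le> 1" for x by (rule \<eta>)
    show "\<eta> (x + t *\<^sub>R axis j 1) = \<eta> x" for x t by (rule \<eta>)
    fix \<alpha> :: "'m \<Rightarrow> nat" assume \<alpha>: "mdeg \<alpha> \<le> r"
    let ?f = "\<lambda>x. if x \<in> cube then \<sigma> x \<alpha> else 0"
    have "smooth ?f"
    \<comment> \<open>The interior of the cube contains \<open>B\<close>, and off \<open>B\<close>
      the extension is zero, so these two open sets cover everything.\<close>
    proof (rule smooth_on_local)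
      fix x
      show "\<exists>U g. x \<in> U \<and> smooth_on U g \<and> (\<forall>y\<in>U. ?f y = g y)"
      proof (cases "x \<in> B")
        case True
        have "smooth_on (interior cube) (\<lambda>x. \<sigma> x \<alpha>)"
          by (rule smooth_on_subset[OF S(2)[OF \<alpha>] open_interior]) (use S(1) interior_subset in blast)
        moreover have "x \<in> interior cube"
          unfolding cube_eq_cbox interior_cbox using True \<rho>0(2)
          by (auto simp: B_iff mem_symmetric_box intro: le_less_trans)
        ultimately show ?thesis
          by (intro exI[of _ "interior cube"] exI[of _ "\<lambda>x. \<sigma> x \<alpha>"]) (use interior_subset in auto)
      next
        case False
        have "smooth_on (- B) (\<lambda>x. 0::real^'n)" by (rule smooth_imp_smooth_on[OF smooth_const oB])
        then show ?thesis using False \<sigma>_out \<alpha>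
          by (intro exI[of _ "- B"] exI[of _ "\<lambda>x. 0"]) auto
      qed
    qed
    then show "smooth (\<tau> \<alpha>)" unfolding \<tau>_def by (rule smooth_scaleR[OF smooth_const])
  qed
  \<comment> \<open>The bounds serve, in order, the required closeness, staying inside the cube, and
    invertibility of the shear through \<open>C * \<bar>Y x\<bar> \<le> 1/2\<close>.\<close>
  define \<epsilon>' where "\<epsilon>' = min \<epsilon> (min (1 - \<rho>) (1 / (2 * (C + 1))))"
  have \<epsilon>': "\<epsilon>' > 0" "\<epsilon>' \<le> \<epsilon>" "\<epsilon>' \<le> 1 - \<rho>" "\<epsilon>' \<le> 1 / (2 * (C + 1))"
    using assms(7) \<rho> C0 by (auto simp: \<epsilon>'_def)
  obtain Y h \<delta> where appr: "approximation r 0 \<epsilon>' Y h \<delta>"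
    using approximable_all[OF assms(3) order_refl \<epsilon>'(1)] unfolding approximable_def by blast
  note appr = appr[unfolded approximation_def graph_fun_def]
  have Y: "smooth Y" "\<And>x t. Y (x + t *\<^sub>R axis j 1) = Y x" "\<And>x. \<eta> x = 0 \<Longrightarrow> Y x = 0" "\<And>x. \<bar>Y x\<bar> < \<epsilon>'"
    using appr by simp_all
  have h: "smooth h" "\<And>x. x \<notin> B \<Longrightarrow> h x = 0" and \<delta>: "\<delta> > 0"
    and h_low: "\<And>\<alpha> x. mdeg \<alpha> \<le> l \<Longrightarrow> norm (mpderiv \<alpha> h x) < \<epsilon>'"
    using appr by simp_all
  have h_near: "norm (mpderiv \<alpha> h x - \<tau> \<alpha> x) < \<epsilon>'" if "\<bar>x $ j - Y x\<bar> < \<delta>" "mdeg \<alpha> \<le> r" for \<alpha> x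
  proof -
    have "mdeg \<alpha> < r \<or> mdeg \<alpha> = r \<and> 0 \<le> \<alpha> j" using that(2) by auto
    then show ?thesis using appr that(1) by blast
  qed
  define F where "F t x = x + (t * \<theta> (x $ j) * Y x) *\<^sub>R axis j 1" for t x
  have CY: "C * \<bar>Y x\<bar> \<le> 1/2" for x
  proof -
    have "C * \<bar>Y x\<bar> \<le> (C + 1) * (1 / (2 * (C + 1)))"
      using Y(4)[of x] \<epsilon>'(4) C0 by (intro mult_mono) auto
    moreover have "(C + 1) * (1 / (2 * (C + 1))) = 1/2" using C0 by (simp add: field_simps)
    ultimately show ?thesis by linarith
  qed
  have F_iso: "isotopy F"
    unfolding F_def[abs_def]
  proof (rule shear_isotopy[OF Y(1,2) \<theta>(1,3,4,5) C \<rho>(2) _ CY])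
    show "\<bar>Y x\<bar> \<le> 1 - \<rho>" for x using Y(4)[of x] \<epsilon>'(3) by linarith
  qed
  let ?U = "{x. \<bar>x $ j - Y x\<bar> < \<delta>}"
  have U_open: "open ?U"
    by (intro open_Collect_less continuous_intros smooth_continuous[OF Y(1)])
  have U_graph: "F 1 ` subcube K \<subseteq> ?U"
  proof clarify
    fix x assume "x \<in> subcube K"
    then have "x $ j = 0" using j by (simp add: subcube_def)
    moreover have "\<theta> 0 = 1" using \<theta>(2) \<rho>0(1) by simp
    \<comment> \<open>At height \<open>0\<close> the cutoff \<theta> is \<open>1\<close>, so the
      final shear adds exactly \<open>Y x\<close> to coordinate \<open>j\<close>. Since
      \<open>Y\<close> does not change in this direction, the image lies on the graph
      itself.\<close>
    ultimately show "\<bar>F 1 x $ j - Y (F 1 x)\<bar> < \<delta>"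
      using \<delta> by (simp add: F_def Y(2))
  qed
  have U_jet: "jet_norm r (\<lambda>\<alpha>. jet r h x \<alpha> - \<sigma> x \<alpha>) < \<epsilon>" if "x \<in> ?U \<inter> cube" for x
  proof (rule jet_norm_less)
    fix \<alpha> :: "'m \<Rightarrow> nat" assume \<alpha>: "mdeg \<alpha> \<le> r"
    have pos: "mfact \<alpha> > 0" using mfact_ge_1[of \<alpha>] by linarith
    then have "jet r h x \<alpha> - \<sigma> x \<alpha> = (mpderiv \<alpha> h x - \<tau> \<alpha> x) /\<^sub>R mfact \<alpha>"
      using \<alpha> that by (simp add: jet_def \<tau>_def scaleR_diff_right)
    then have "norm (jet r h x \<alpha> - \<sigma> x \<alpha>) = norm (mpderiv \<alpha> h x - \<tau> \<alpha> x) / mfact \<alpha>"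
      using pos by (simp add: divide_inverse)
    also have "\<dots> \<le> norm (mpderiv \<alpha> h x - \<tau> \<alpha> x)"
      using mfact_ge_1[of \<alpha>] by (simp add: divide_le_eq mult_le_cancel_left1 pos)
    also have "\<dots> < \<epsilon>" using h_near[of x \<alpha>] that \<alpha> \<epsilon>'(2) by auto
    finally show "norm (jet r h x \<alpha> - \<sigma> x \<alpha>) < \<epsilon>" .
  qed
  have jet_low: "jet_norm l (jet r h x) < \<epsilon>" for x
  proof (rule jet_norm_less)
    fix \<alpha> :: "'m \<Rightarrow> nat" assume \<alpha>: "mdeg \<alpha> \<le> l"
    have pos: "mfact \<alpha> > 0" using mfact_ge_1[of \<alpha>] by linarith
    have "norm (jet r h x \<alpha>) = norm (mpderiv \<alpha> h x) / mfact \<alpha>"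
      using \<alpha> assms(3) pos by (simp add: jet_def divide_inverse)
    also have "\<dots> \<le> norm (mpderiv \<alpha> h x)"
      using mfact_ge_1[of \<alpha>] by (simp add: divide_le_eq mult_le_cancel_left1 pos)
    also have "\<dots> < \<epsilon>" using h_low[OF \<alpha>, of x] \<epsilon>'(2) by linarith
    finally show "norm (jet r h x \<alpha>) < \<epsilon>" .
  qed
  have F_close: "dist (F t x) x < \<epsilon>" if "t \<in> {0..1}" for t x
  proof -
    have "dist (F t x) x = t * \<theta> (x $ j) * \<bar>Y x\<bar>"
      using that \<theta>(4)[of "x $ j"] by (simp add: F_def dist_norm abs_mult)
    also have "\<dots> \<le> 1 * 1 * \<bar>Y x\<bar>"
      using that \<theta>(4,5)[of "x $ j"] by (intro mult_mono) auto
    also have "\<dots> < \<epsilon>" using Y(4)[of x] \<epsilon>'(2) by linarith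
    finally show ?thesis .
  qed
  have boundary: "\<exists>V. open V \<and> frontier cube \<subseteq> V \<and>
        (\<forall>x\<in>V \<inter> cube. (\<forall>t\<in>{0..1}. F t x = x) \<and> jet_zero r (jet r h x))"
  proof -
    let ?B = "cbox (\<chi> i. -\<rho>) (\<chi> i. \<rho>) :: (real^'m) set"
    have B'_iff: "x \<in> ?B \<longleftrightarrow> (\<forall>i. \<bar>x $ i\<bar> \<le> \<rho>)" for x by (rule mem_symmetric_box)
    have "open (- ?B)" by (simp add: open_Compl closed_cbox)
    moreover have "frontier cube \<subseteq> - ?B"
    proof
      fix x :: "real^'m" assume "x \<in> frontier cube"
      then obtain i where "\<bar>x $ i\<bar> = 1" unfolding frontier_cube by blast
      then have "\<not> \<bar>x $ i\<bar> \<le> \<rho>" using \<rho>(2) by simp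
      then show "x \<in> - ?B" unfolding Compl_iff B'_iff by blast
    qed
    moreover have "F t x = x" if out: "x \<notin> ?B" for t x
    proof -
      \<comment> \<open>If the large coordinate is \<open>j\<close>, then \<theta> stops the shear;
        otherwise a factor of \<eta> vanishes and \<open>Y\<close> with it.\<close>
      obtain i where i: "\<bar>x $ i\<bar> > \<rho>" using out unfolding B'_iff by (auto simp: not_le)
      show ?thesis
      proof (cases "i = j")
        case True
        then show ?thesis using i \<theta>(3) by (simp add: F_def)
      next
        case False
        then have "\<eta> x = 0" using i \<theta>(3)[of "x $ i"] unfolding \<eta>_def by (intro prod_zero) auto
        then show ?thesis using Y(3) by (simp add: F_def)
      qed
    qed
    moreover have "jet_zero r (jet r h x)" if "x \<notin> ?B" for x
    proof -
      have "x \<in> - B" using that \<rho>(1) unfolding Compl_iff B_iff B'_iff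
        by (meson less_imp_le order_trans)
      then have "mpderiv \<alpha> h x = 0" for \<alpha>
        using iter_pd_cong_open[OF oB, of x h "\<lambda>x. 0" "mlist \<alpha>"] h(2) by (simp add: mpderiv_mlist iter_pd_zero)
      then show ?thesis by (simp add: jet_zero_def jet_def)
    qed
    ultimately show ?thesis by (intro exI[of _ "- ?B"]) auto
  qed
  have "\<exists>S. cube \<subseteq> S \<and> smooth_on S h" using h(1) by blast
  moreover have "\<exists>U. open U \<and> F 1 ` subcube K \<subseteq> U \<and>
        (\<forall>x\<in>U \<inter> cube. jet_norm r (\<lambda>\<alpha>. jet r h x \<alpha> - \<sigma> x \<alpha>) < \<epsilon>)"
    using U_open U_graph U_jet by (intro exI[of _ ?U] conjI ballI)
  ultimately show ?thesis
    using F_iso jet_low F_close boundary by (intro exI[of _ F] exI[of _ h] conjI ballI)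
qed

end
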